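(* Let $E$ be a finite-dimensional real inner product space and let $C(t)=\bigcap_{i=1}^k(C_i+c_i(t))$ be uniformly bounded, where $C_1,\dots,C_k\subset E$ are closed convex sets, the first $p$ of which are polyhedral, and $c_i$ are single-valued Lipschitz continuous $T$-periodic functions such that $$\bigcap_{i=1}^p(C_i+c_i(t))\cap\bigcap_{i=p+1}^k(\mathrm{ri}(C_i)+c_i(t))\neq\emptyset,\quad t\in[0,T].$$ Then the set $X(t)$ of $T$-periodic solutions of $-\dot x\in N^0_{C(t)}(x)$ is a global attractor of this sweeping process.
   Context: $(\cdot,\cdot)_0$ is the inner product on $E$, $\|\cdot\|_0$ its norm. $N^0_K(x)=\{\zeta:(\zeta,c-x)_0\le0\ \forall c\in K\}$ if $x\in K$, $\emptyset$ otherwise. Solutions are Lipschitz functions $x$ with $x(t)\in C(t)$ satisfying the inclusion a.e.; $X(t)=\{x(t): x \text{ a solution on }[0,\infty)\text{ with } x(T)=x(0)\}$. A set-valued $Y(t)$ is a global attractor if $\mathrm{dist}(x(t),Y(t))\to0$ as $t\to\infty$ for every solution $x$. $\mathrm{ri}$ denotes relative interior. *)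

theory Defs
  imports "HOL-Analysis.Analysis"
begin

definition normal_cone :: "'a::euclidean_space set \<Rightarrow> 'a \<Rightarrow> 'a set" where
  "normal_cone K x = (if x \<in> K then {\<zeta>. \<forall>c\<in>K. \<zeta> \<bullet> (c - x) \<le> 0} else {})"

definition translate :: "'a::euclidean_space set \<Rightarrow> 'a \<Rightarrow> 'a set" where
  "translate A v = (\<lambda>y. y + v) ` A"

definition sweeping_solution :: "(real \<Rightarrow> 'a::euclidean_space set) \<Rightarrow> (real \<Rightarrow> 'a) \<Rightarrow> bool" where
  "sweeping_solution Cs x \<longleftrightarrow>
     (\<exists>L. L-lipschitz_on {0..} x) \<and>
     (\<forall>t\<ge>0. x t \<in> Cs t) \<and>
     (AE t in lborel. t \<ge> 0 \<longrightarrow>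
        (\<exists>v. (x has_vector_derivative v) (at t) \<and> - v \<in> normal_cone (Cs t) (x t)))"

definition periodic_set :: "(real \<Rightarrow> 'a::euclidean_space set) \<Rightarrow> real \<Rightarrow> real \<Rightarrow> 'a set" where
  "periodic_set Cs T t = {x t | x. sweeping_solution Cs x \<and> x T = x 0}"

end

theory Submission
  imports Defs
begin

text \<open>
  Slater's condition makes the intersection \<open>C(t)\<close> depend on the translations \<open>c\<^sub>i\<close> in a Lipschitz way, for the
  Hausdorff distance; this gives existence of solutions by the catching-up algorithm. The distance of two
  solutions never increases. If it is constant, then at almost every time the velocities \<open>x', y'\<close> satisfy
  \<open>x' \<bullet> (y - x) = y' \<bullet> (y - x) = 0\<close>. Since each \<open>C\<^sub>i\<close> only moves by translation, the midpoint of \<open>x\<close> and \<open>y\<close> can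
  then be moved infinitesimally by \<open>\<plusminus>(y' - x')\<close> without leaving \<open>C(t)\<close>. Testing this with the normal vectors
  \<open>- x'\<close> and \<open>- y'\<close> yields \<open>x' = y'\<close>: solutions at constant distance are translates of each other.

  Given a solution \<open>x\<close>, let \<open>y\<close> start at a limit point of \<open>x(nT)\<close>. Then \<open>|y(t + T) - y(t)|\<close> is the limit of the
  nonincreasing quantity \<open>|x(t + T) - x(t)|\<close>, hence constant, so \<open>y(t + T) - y(t)\<close> is a constant vector, which
  vanishes because \<open>y\<close> is bounded. Thus \<open>y\<close> is periodic, and \<open>|x - y|\<close> tends to \<open>0\<close>.
\<close>

section \<open>Lipschitz functions of a real variable\<close>

text \<open>Velocities exist only almost everywhere, so every pointwise inequality has to be
  integrated by means of Lipschitz continuity. This is the purpose of the monotonicity lemmas;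
  differentiability almost everywhere is needed for the limit of the approximations and also for the
  \<open>c i\<close>. The geometric obstacle is that a point close to every translated set can be
  far from their intersection. Slater's condition excludes this with an estimate linear in the
  perturbation, and linearity matters in both uses: it makes each catching-up step O(h), and it
  keeps the o(h) error of the midpoint argument at o(h). Polyhedral sets need no interior point
  because a solvable linear system always obeys such an estimate (Hoffman); for the other sets the
  relative interior supplies the room. The two tests of the midpoint motion read
  \<open>(- x') \<bullet> (y' - x') \<le> 0\<close> and
  \<open>(- y') \<bullet> (x' - y') \<le> 0\<close>; their sum is
  \<open>(x' - y') \<bullet> (x' - y') \<le> 0\<close>.\<close>

lemma continuous_nonincreasing_rightI:
  fixes g :: "real \<Rightarrow> real"
  assumes "a \<le> b" and cont: "continuous_on {a..b} g"
    and step: "\<And>t. a \<le> t \<Longrightarrow> t < b \<Longrightarrow> \<exists>h>0. t + h \<le> b \<and> g (t + h) \<le> g t"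
  shows "g b \<le> g a"
proof -
  \<comment> \<open>Continuous induction: \<open>S\<close> is closed, hence contains its supremum,
    and an admissible step from a supremum below \<open>b\<close> would reach a larger element of
    \<open>S\<close>.\<close>
  define S where "S = {t \<in> {a..b}. g t \<le> g a}"
  have "closed S"
    unfolding S_def using cont by (intro continuous_on_closed_Collect_le) auto
  have "a \<in> S" "bdd_above S"
    using \<open>a \<le> b\<close> by (auto simp: S_def bdd_above_def)
  then have s: "Sup S \<in> S"
    using \<open>closed S\<close> closed_contains_Sup by blast
  have "Sup S = b"
  proof (rule ccontr)
    assume "Sup S \<noteq> b"
    then have "a \<le> Sup S" "Sup S < b"
      using s by (auto simp: S_def)
    then obtain h where "h > 0" "Sup S + h \<le> b" "g (Sup S + h) \<le> g (Sup S)"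
      using step by blast
    then have "Sup S + h \<in> S"
      using s by (auto simp: S_def)
    then show False
      using \<open>h > 0\<close> \<open>bdd_above S\<close> cSup_upper by fastforce
  qed
  then show ?thesis
    using s by (simp add: S_def)
qed

text \<open>The sign \<open>\<sigma>\<close> records on which side of a point the small steps are
  available; a one-sided slope condition gives no choice in this. Steps to the left become steps to
  the right under \<open>t \<mapsto> - t\<close>, with \<open>g\<close> negated to preserve the
  direction of monotonicity.\<close>

lemma continuous_nonincreasingI:
  fixes g :: "real \<Rightarrow> real"
  assumes "a \<le> b" and cont: "continuous_on {a..b} g" and \<sigma>: "\<sigma> = 1 \<or> \<sigma> = (-1::real)"
    and step: "\<And>t. t \<in> {a..b} \<Longrightarrow> t \<noteq> (if \<sigma> = 1 then b else a) \<Longrightarrow>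
      \<exists>h>0. t + \<sigma> * h \<in> {a..b} \<and> \<sigma> * (g (t + \<sigma> * h) - g t) \<le> 0"
  shows "g b \<le> g a"
proof (cases "\<sigma> = 1")
  case True
  show ?thesis
    by (rule continuous_nonincreasing_rightI[OF assms(1,2)]) (use step True in fastforce)
next
  case False
  then have \<sigma>: "\<sigma> = -1" using \<sigma> by simp
  have "(\<lambda>t. - g (- t)) (- a) \<le> (\<lambda>t. - g (- t)) (- b)"
  proof (rule continuous_nonincreasing_rightI[of "-b" "-a" "\<lambda>t. - g (- t)"])
    show "continuous_on {- b..- a} (\<lambda>t. - g (- t))"
      by (intro continuous_intros continuous_on_compose2[OF cont]) auto
    fix t assume "- b \<le> t" "t < - a"
    then show "\<exists>h>0. t + h \<le> - a \<and> - g (- (t + h)) \<le> - g (- t)"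
      using step[of "-t"] \<sigma> by (auto simp: algebra_simps)
  qed (use \<open>a \<le> b\<close> in auto)
  then show ?thesis by simp
qed

text \<open>
  The part of \<open>[a, b]\<close> outside \<open>E\<close> is covered by an open set \<open>V\<close>; after subtracting
  \<open>\<alpha> t + (L + \<bar>\<alpha>\<bar>) |V \<inter> [a, t]|\<close> every point admits a small step along which the function does not grow.
\<close>

lemma lipschitz_increment_le:
  fixes f :: "real \<Rightarrow> real"
  assumes "a \<le> b" and lip: "L-lipschitz_on {a..b} f" and \<sigma>: "\<sigma> = 1 \<or> \<sigma> = (-1::real)"
    and E: "E \<in> sets lebesgue"
    and slope: "\<And>t d. t \<in> E \<Longrightarrow> d > 0 \<Longrightarrow> \<exists>h. 0 < h \<and> h < d \<and> \<sigma> * (f (t + \<sigma> * h) - f t) \<le> \<alpha> * h"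
  shows "f b - f a \<le> \<alpha> * (b - a) + (L + \<bar>\<alpha>\<bar>) * measure lebesgue ({a..b} - E)"
proof -
  \<comment> \<open>At uncontrolled points \<open>f\<close> can gain at rate \<open>L\<close> and
    the term \<open>- \<alpha> * t\<close> at rate at most \<open>\<bar>\<alpha>\<bar>\<close>;
    \<open>M\<close> is the rate that compensates for both.\<close>
  define M where "M = L + \<bar>\<alpha>\<bar>"
  define F where "F = {a..b} - E"
  have "M \<ge> 0"
    using lipschitz_on_nonneg[OF lip] by (simp add: M_def)
  have F: "F \<in> sets lebesgue" "F \<in> lmeasurable"
    using E by (auto simp: F_def intro!: fmeasurable_Diff)
  have main: "f b - f a \<le> \<alpha> * (b - a) + M * (measure lebesgue F + e)" if "e > 0" for e
  proof -
    obtain V where V: "open V" "F \<subseteq> V" "V - F \<in> lmeasurable" "emeasure lebesgue (V - F) < ennreal e"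
      using sets_lebesgue_outer_open[OF F(1) \<open>e > 0\<close>] .
    define \<phi> where "\<phi> t = measure lebesgue (V \<inter> {a..t})" for t
    have meas: "V \<inter> {a..t} \<in> lmeasurable" "V \<inter> {t<..s} \<in> lmeasurable" for t s
      using \<open>open V\<close>
      by (auto intro!: bounded_set_imp_lmeasurable intro: bounded_subset[of "{a..t}"] bounded_subset[of "{t..s}"])
    have diff: "\<phi> s - \<phi> t = measure lebesgue (V \<inter> {t<..s})" if "a \<le> t" "t \<le> s" for s t
    proof -
      have "V \<inter> {t<..s} = (V \<inter> {a..s}) - (V \<inter> {a..t})"
        using that by auto
      then show ?thesis
        using that by (simp add: \<phi>_def measurable_measure_Diff meas fmeasurableD subset_iff)
    qed
    have up: "0 \<le> \<phi> s - \<phi> t" "\<phi> s - \<phi> t \<le> s - t" if "a \<le> t" "t \<le> s" for s t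
    proof -
      have "measure lebesgue (V \<inter> {t<..s}) \<le> measure lebesgue {t<..s}"
        using meas by (intro measure_mono_fmeasurable bounded_set_imp_lmeasurable) auto
      then show "0 \<le> \<phi> s - \<phi> t" "\<phi> s - \<phi> t \<le> s - t"
        using that by (auto simp: diff)
    qed
    have eq: "\<phi> s - \<phi> t = s - t" if "a \<le> t" "t \<le> s" "{t..s} \<subseteq> V" for s t
    proof -
      have "V \<inter> {t<..s} = {t<..s}"
        using that(3) by auto
      then show ?thesis
        using that by (simp add: diff)
    qed
    have "\<bar>\<phi> s - \<phi> t\<bar> \<le> \<bar>s - t\<bar>" if "s \<in> {a..b}" "t \<in> {a..b}" for s t
      using up[of s t] up[of t s] that by (cases "s \<le> t") auto
    then have "1-lipschitz_on {a..b} \<phi>"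
      by (intro lipschitz_onI) (auto simp: dist_real_def)
    then have "continuous_on {a..b} (\<lambda>t. f t - \<alpha> * t - M * \<phi> t)"
      using lip by (intro continuous_intros) (auto intro: lipschitz_on_continuous_on)
    then have "(\<lambda>t. f t - \<alpha> * t - M * \<phi> t) b \<le> (\<lambda>t. f t - \<alpha> * t - M * \<phi> t) a"
    proof (rule continuous_nonincreasingI[OF \<open>a \<le> b\<close> _ \<sigma>])
      fix t assume t: "t \<in> {a..b}" "t \<noteq> (if \<sigma> = 1 then b else a)"
      define d where "d = (if \<sigma> = 1 then b - t else t - a)"
      have d: "t + \<sigma> * h \<in> {a..b}" if "0 \<le> h" "h \<le> d" for h
        using t \<sigma> that by (auto simp: d_def split: if_splits)
      have "d > 0"
        using t \<sigma> by (auto simp: d_def split: if_splits)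
      show "\<exists>h>0. t + \<sigma> * h \<in> {a..b} \<and>
        \<sigma> * (f (t + \<sigma> * h) - \<alpha> * (t + \<sigma> * h) - M * \<phi> (t + \<sigma> * h) - (f t - \<alpha> * t - M * \<phi> t)) \<le> 0"
      proof (cases "t \<in> E")
        case True
        then obtain h where h: "0 < h" "h < d" "\<sigma> * (f (t + \<sigma> * h) - f t) \<le> \<alpha> * h"
          using slope \<open>d > 0\<close> by blast
        then have "t + \<sigma> * h \<in> {a..b}"
          using d by simp
        moreover have "0 \<le> \<sigma> * (\<phi> (t + \<sigma> * h) - \<phi> t)"
          using \<sigma> h(1) up(1)[of t "t + h"] up(1)[of "t - h" t] t calculation by auto
        then have "0 \<le> M * (\<sigma> * (\<phi> (t + \<sigma> * h) - \<phi> t))"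
          using \<open>M \<ge> 0\<close> by simp
        moreover have "\<sigma> * (\<alpha> * (t + \<sigma> * h) - \<alpha> * t) = \<alpha> * h"
          using \<sigma> by (auto simp: algebra_simps)
        moreover have "\<sigma> * (f (t + \<sigma> * h) - \<alpha> * (t + \<sigma> * h) - M * \<phi> (t + \<sigma> * h) - (f t - \<alpha> * t - M * \<phi> t))
          = \<sigma> * (f (t + \<sigma> * h) - f t) - \<sigma> * (\<alpha> * (t + \<sigma> * h) - \<alpha> * t) - M * (\<sigma> * (\<phi> (t + \<sigma> * h) - \<phi> t))"
          by (simp add: algebra_simps)
        ultimately show ?thesis
          using h by (intro exI[of _ h] conjI) linarith+
      next
        case False
        then have "t \<in> V"
          using t V by (auto simp: F_def)
        then obtain r where r: "r > 0" "ball t r \<subseteq> V"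
          using \<open>open V\<close> open_contains_ball by blast
        define h where "h = min d (r / 2)"
        have h: "0 < h" "h \<le> d" "h < r"
          using \<open>d > 0\<close> r by (auto simp: h_def min_def)
        have in_ab: "t + \<sigma> * h \<in> {a..b}"
          using d h by simp
        have "M * (\<sigma> * (\<phi> (t + \<sigma> * h) - \<phi> t)) = M * h"
        proof -
          have "{t..t + h} \<subseteq> V" "{t - h..t} \<subseteq> V"
            using r h by (auto simp: dist_real_def subset_iff)
          then show ?thesis
            using \<sigma> h eq[of t "t + h"] eq[of "t - h" t] t in_ab by auto
        qed
        moreover have "\<sigma> * (f (t + \<sigma> * h) - f t) \<le> L * h"
          using lipschitz_onD[OF lip in_ab t(1)] \<sigma> h by (auto simp: dist_real_def)
        moreover have "\<sigma> * (\<alpha> * (t + \<sigma> * h) - \<alpha> * t) = \<alpha> * h"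
          using \<sigma> by (auto simp: algebra_simps)
        moreover have "L * h - \<alpha> * h - M * h \<le> 0"
        proof -
          have "L * h - \<alpha> * h - M * h = (- \<bar>\<alpha>\<bar> - \<alpha>) * h"
            by (simp add: M_def algebra_simps)
          also have "\<dots> \<le> 0"
            using h by (intro mult_nonpos_nonneg) auto
          finally show ?thesis .
        qed
        moreover have "\<sigma> * (f (t + \<sigma> * h) - \<alpha> * (t + \<sigma> * h) - M * \<phi> (t + \<sigma> * h) - (f t - \<alpha> * t - M * \<phi> t))
          = \<sigma> * (f (t + \<sigma> * h) - f t) - \<sigma> * (\<alpha> * (t + \<sigma> * h) - \<alpha> * t) - M * (\<sigma> * (\<phi> (t + \<sigma> * h) - \<phi> t))"
          by (simp add: algebra_simps)
        ultimately show ?thesis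
          using h in_ab by (intro exI[of _ h] conjI) linarith+
      qed
    qed
    moreover have "\<phi> b \<le> measure lebesgue F + e"
    proof -
      have "\<phi> b \<le> measure lebesgue (F \<union> (V - F))"
        unfolding \<phi>_def using F V meas
        by (intro measure_mono_fmeasurable fmeasurable.Un) (auto simp: fmeasurableD)
      also have "\<dots> \<le> measure lebesgue F + measure lebesgue (V - F)"
        using F V by (intro measure_Un_le) (auto simp: fmeasurableD)
      also have "measure lebesgue (V - F) \<le> e"
        using V(3,4) \<open>e > 0\<close> by (simp add: emeasure_eq_measure2 ennreal_less_iff less_imp_le)
      finally show ?thesis by simp
    qed
    then have "M * \<phi> b \<le> M * (measure lebesgue F + e)"
      using \<open>M \<ge> 0\<close> by (rule mult_left_mono)
    moreover have "0 \<le> M * \<phi> a"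
      using \<open>M \<ge> 0\<close> by (simp add: \<phi>_def)
    moreover have "\<alpha> * b - \<alpha> * a = \<alpha> * (b - a)"
      by (simp add: algebra_simps)
    ultimately show ?thesis by linarith
  qed
  have "f b - f a - \<alpha> * (b - a) - M * measure lebesgue F \<le> 0 + e" if "e > 0" for e
  proof -
    have "M * (e / (M + 1)) \<le> e"
      using that \<open>M \<ge> 0\<close> by (simp add: field_simps)
    then show ?thesis
      using main[of "e / (M + 1)"] that \<open>M \<ge> 0\<close> by (simp add: distrib_left)
  qed
  then have "f b - f a - \<alpha> * (b - a) - M * measure lebesgue F \<le> 0"
    using field_le_epsilon by blast
  then show ?thesis
    by (simp add: M_def F_def)
qed

text \<open>Growth on a null set, as for the Cantor function, is impossible here because the error
  term of \<open>lipschitz_increment_le\<close> is a multiple of the measure of the exceptional set.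
  The remaining slope bound \<open>\<alpha> > 0\<close> is arbitrary.\<close>

lemma lipschitz_nonincreasingI:
  fixes f :: "real \<Rightarrow> real"
  assumes "a \<le> b" and lip: "L-lipschitz_on {a..b} f" and N: "negligible N"
    and deriv: "\<And>t. t \<in> {a<..<b} - N \<Longrightarrow> \<exists>D\<le>0. (f has_real_derivative D) (at t)"
  shows "f b \<le> f a"
proof -
  define E where "E = {a<..<b} - N"
  have E: "E \<in> sets lebesgue"
    using negligible_imp_sets[OF N] by (auto simp: E_def)
  have "{a..b} - E \<subseteq> N \<union> {a, b}"
    by (auto simp: E_def)
  then have "negligible ({a..b} - E)"
    using N negligible_subset by (metis negligible_Un negligible_insert negligible_empty)
  then have 0: "measure lebesgue ({a..b} - E) = 0"
    by (simp add: negligible_iff_measure)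
  have "f b - f a \<le> 0 + e" if "e > 0" for e
  proof -
    \<comment> \<open>The summand \<open>1\<close> in the denominator covers the degenerate interval
      \<open>a = b\<close>.\<close>
    define \<alpha> where "\<alpha> = e / (b - a + 1)"
    have "\<alpha> > 0"
      using that \<open>a \<le> b\<close> by (simp add: \<alpha>_def)
    have "f b - f a \<le> \<alpha> * (b - a) + (L + \<bar>\<alpha>\<bar>) * measure lebesgue ({a..b} - E)"
    proof (rule lipschitz_increment_le[OF \<open>a \<le> b\<close> lip _ E])
      fix t d :: real assume "t \<in> E" "d > 0"
      then obtain D where D: "D \<le> 0" "(f has_real_derivative D) (at t)"
        using deriv by (auto simp: E_def)
      then have "((\<lambda>h. (f (t + h) - f t) / h) \<longlongrightarrow> D) (at 0)"
        by (simp add: DERIV_def)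
      then have "\<forall>\<^sub>F h in at 0. (f (t + h) - f t) / h < \<alpha>"
        using D(1) \<open>\<alpha> > 0\<close> order_tendstoD(2)[of _ D] by fastforce
      then obtain r where r: "r > 0" "\<And>h. h \<noteq> 0 \<Longrightarrow> \<bar>h\<bar> < r \<Longrightarrow> (f (t + h) - f t) / h < \<alpha>"
        by (auto simp: eventually_at dist_real_def)
      define h where "h = min d r / 2"
      have "0 < h" "h < d" "h < r"
        using \<open>d > 0\<close> \<open>r > 0\<close> by (auto simp: h_def min_def)
      then show "\<exists>h. 0 < h \<and> h < d \<and> 1 * (f (t + 1 * h) - f t) \<le> \<alpha> * h"
        using r(2)[of h] by (intro exI[of _ h]) (auto simp: field_simps)
    qed simp
    also have "\<dots> = \<alpha> * (b - a)"
      by (simp add: 0)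
    also have "\<dots> \<le> e"
      using that \<open>a \<le> b\<close> by (simp add: \<alpha>_def field_simps)
    finally show ?thesis by simp
  qed
  then have "f b - f a \<le> 0"
    using field_le_epsilon by blast
  then show ?thesis by simp
qed

section \<open>Differentiability almost everywhere of Lipschitz functions\<close>

text \<open>An elementary form of Lebesgue density. In a cover of \<open>E\<close> by nonoverlapping
  intervals whose total length exceeds the measure of \<open>E\<close> by at most \<open>e\<close>,
  the part outside \<open>E\<close> has measure at most \<open>e\<close>, yet at least
  \<open>\<theta>\<close> times the total length. So that length, and with it the measure of
  \<open>E\<close>, is at most \<open>e / \<theta>\<close>.\<close>

lemma negligible_of_interval_deficit:
  fixes E :: "real set"
  assumes E: "E \<in> sets lebesgue" "E \<subseteq> {a..b}" and "\<theta> > 0"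
    and deficit: "\<And>u v. u \<le> v \<Longrightarrow> \<theta> * (v - u) \<le> measure lebesgue ({u..v} - E)"
  shows "negligible E"
proof -
  have Em: "E \<in> lmeasurable"
    using E bounded_subset[OF bounded_closed_interval[of a b]] by (intro bounded_set_imp_lmeasurable) auto
  have "\<theta> * measure lebesgue E \<le> 0 + e" if "e > 0" for e
  proof -
    obtain D where D: "countable D" "\<And>K. K \<in> D \<Longrightarrow> K \<subseteq> cbox a b \<and> K \<noteq> {} \<and> (\<exists>c d. K = cbox c d)"
       "pairwise (\<lambda>A B. interior A \<inter> interior B = {}) D"
       "E \<subseteq> \<Union>D" "\<Union>D \<in> lmeasurable" "measure lebesgue (\<Union>D) \<le> measure lebesgue E + e"
      using measurable_outer_intervals_bounded[OF Em _ \<open>e > 0\<close>, of a b] E(2) by (metis box_real(2))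
    \<comment> \<open>Finite subfamilies are additive because distinct intervals meet only in their
      frontiers; the bound is independent of the subfamily and thus passes to the countable
      union.\<close>
    have fin: "\<theta> * measure lebesgue (\<Union>\<F>) \<le> e" if \<F>: "\<F> \<subseteq> D" "finite \<F>" for \<F>
    proof -
      have cb: "\<exists>u v. u \<le> v \<and> K = {u..v}" if "K \<in> \<F>" for K
        using D(2) \<F> that by (metis box_real(2) atLeastatMost_empty_iff subsetD)
      then have lm: "K \<in> lmeasurable" if "K \<in> \<F>" for K
        using that by blast
      have lmE: "K - E \<in> lmeasurable" if "K \<in> \<F>" for K
        using that lm Em by (simp add: fmeasurable_Diff fmeasurableD)
      have neg: "negligible (K \<inter> K')" if KK: "K \<in> \<F>" "K' \<in> \<F>" "K \<noteq> K'" for K K'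
      proof -
        obtain u v u' v' where uv: "K = {u..v}" "K' = {u'..v'}"
          using cb[OF KK(1)] cb[OF KK(2)] by auto
        have "interior K \<inter> interior K' = {}"
          using D(3) KK \<F> by (auto simp: pairwise_def)
        then have "K \<inter> K' \<subseteq> frontier K \<union> frontier K'"
          using uv by (auto simp: frontier_def)
        moreover have "negligible (frontier K \<union> frontier K')"
          using uv by (intro negligible_Un negligible_convex_frontier) auto
        ultimately show ?thesis
          using negligible_subset by blast
      qed
      have "\<theta> * measure lebesgue (\<Union>\<F>) = (\<Sum>K\<in>\<F>. \<theta> * measure lebesgue K)"
        using measure_negligible_finite_Union[OF \<F>(2) lm] neg
        by (simp add: pairwise_def sum_distrib_left)
      also have "\<dots> \<le> (\<Sum>K\<in>\<F>. measure lebesgue (K - E))"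
      proof (rule sum_mono)
        fix K assume "K \<in> \<F>"
        then obtain u v where "u \<le> v" "K = {u..v}"
          using cb by blast
        then show "\<theta> * measure lebesgue K \<le> measure lebesgue (K - E)"
          using deficit[of u v] by simp
      qed
      also have "\<dots> = measure lebesgue (\<Union>K\<in>\<F>. K - E)"
      proof (rule measure_negligible_finite_Union_image[symmetric, OF \<F>(2) lmE])
        show "pairwise (\<lambda>K K'. negligible ((K - E) \<inter> (K' - E))) \<F>"
          using neg by (auto simp: pairwise_def intro: negligible_subset)
      qed
      also have "\<dots> \<le> measure lebesgue (\<Union>D - E)"
        using \<F> lmE D(5) Em by (intro measure_mono_fmeasurable sets.finite_UN) (auto simp: fmeasurableD fmeasurable_Diff)
      also have "\<dots> = measure lebesgue (\<Union>D) - measure lebesgue E"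
        using D Em by (simp add: measurable_measure_Diff fmeasurableD)
      finally show ?thesis
        using D(6) by simp
    qed
    have "measure lebesgue (\<Union>D) \<le> e / \<theta>"
    proof (cases "D = {}")
      case False
      have "measure lebesgue (\<Union>(range (from_nat_into D))) \<le> e / \<theta>"
      proof (rule measure_countable_Union_le)
        show "from_nat_into D n \<in> lmeasurable" for n
          using D(2)[OF from_nat_into[OF False]] by (metis lmeasurable_cbox)
        have "from_nat_into D ` {..n} \<subseteq> D" for n
          using from_nat_into[OF False] by auto
        then show "measure lebesgue (\<Union>(from_nat_into D ` {..n})) \<le> e / \<theta>" for n
          using fin[of "from_nat_into D ` {..n}"] \<open>\<theta> > 0\<close> by (simp add: field_simps)
      qed
      then show ?thesis
        by (simp add: range_from_nat_into[OF False D(1)])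
    qed (use \<open>e > 0\<close> \<open>\<theta> > 0\<close> in simp)
    moreover have "measure lebesgue E \<le> measure lebesgue (\<Union>D)"
      using D Em by (intro measure_mono_fmeasurable) (auto simp: fmeasurableD)
    ultimately have "measure lebesgue E \<le> e / \<theta>"
      by simp
    then show ?thesis
      using \<open>\<theta> > 0\<close> by (simp add: field_simps)
  qed
  then have "\<theta> * measure lebesgue E \<le> 0"
    using field_le_epsilon by blast
  then have "measure lebesgue E = 0"
    using \<open>\<theta> > 0\<close> by (simp add: mult_le_0_iff measure_le_0_iff)
  then show ?thesis
    using Em by (simp add: negligible_iff_measure)
qed

text \<open>
  Where both kinds of secants occur, the two increment bounds force \<open>E\<close> to miss
  a fixed proportion of every interval.
\<close>

lemma lipschitz_slope_gap_negligible:
  fixes f :: "real \<Rightarrow> real"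
  assumes lip: "L-lipschitz_on UNIV f" and "\<alpha> < \<beta>"
    and \<sigma>: "\<sigma> = 1 \<or> \<sigma> = (-1::real)" and \<tau>: "\<tau> = 1 \<or> \<tau> = (-1::real)"
  shows "negligible {t \<in> {a..b}. (\<forall>d>0. \<exists>h. 0 < h \<and> h < d \<and> \<sigma> * (f (t + \<sigma> * h) - f t) < \<alpha> * h) \<and>
     (\<forall>d>0. \<exists>h. 0 < h \<and> h < d \<and> \<beta> * h < \<tau> * (f (t + \<tau> * h) - f t))}" (is "negligible ?E")
proof -
  define S where "S g \<rho> c = {t. \<forall>d>0. \<exists>h. 0 < h \<and> h < d \<and> \<rho> * (g (t + \<rho> * h) - g t) < c * h}"
    for g :: "real \<Rightarrow> real" and \<rho> c :: real
  have meas: "S g \<rho> c \<in> sets lebesgue" if cont: "continuous_on UNIV g" for g \<rho> c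
  proof -
    \<comment> \<open>For measurability, the union over \<open>h\<close> may stay uncountable
      because it consists of open sets; only the quantifier over \<open>d\<close> has to be reduced
      to a countable one.\<close>
    have "S g \<rho> c = (\<Inter>n::nat. \<Union>h\<in>{0<..<inverse (Suc n)}. {t. \<rho> * (g (t + \<rho> * h) - g t) < c * h})"
      (is "_ = ?R")
    proof (intro equalityI subsetI)
      fix t assume t: "t \<in> ?R"
      show "t \<in> S g \<rho> c"
        unfolding S_def
      proof (safe)
        fix d :: real assume "d > 0"
        then obtain n where "inverse (of_nat (Suc n)) < d"
          using reals_Archimedean by blast
        moreover obtain h where "0 < h" "h < inverse (of_nat (Suc n))" "\<rho> * (g (t + \<rho> * h) - g t) < c * h"
          using t by (force simp del: of_nat_Suc)
        ultimately show "\<exists>h>0. h < d \<and> \<rho> * (g (t + \<rho> * h) - g t) < c * h"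
          by (intro exI[of _ h]) auto
      qed
    next
      fix t assume t: "t \<in> S g \<rho> c"
      show "t \<in> ?R"
      proof
        fix n :: nat
        have "inverse (real (Suc n)) > 0" by simp
        then obtain h where "0 < h" "h < inverse (real (Suc n))" "\<rho> * (g (t + \<rho> * h) - g t) < c * h"
          using t unfolding S_def by blast
        then show "t \<in> (\<Union>h\<in>{0<..<inverse (real (Suc n))}. {t. \<rho> * (g (t + \<rho> * h) - g t) < c * h})"
          by (intro UN_I[of h]) auto
      qed
    qed
    moreover have "open {t. \<rho> * (g (t + \<rho> * h) - g t) < c * h}" for h
      by (intro open_Collect_less continuous_intros continuous_on_compose2[OF cont]) auto
    then have "?R \<in> sets borel"
      by (intro sets.countable_INT) (auto intro!: borel_open)
    ultimately show ?thesis
      by simp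
  qed
  have E_eq: "?E = {a..b} \<inter> S f \<sigma> \<alpha> \<inter> S (\<lambda>t. - f t) \<tau> (- \<beta>)"
    by (auto simp: S_def algebra_simps)
  have contf: "continuous_on UNIV f"
    using lip by (rule lipschitz_on_continuous_on)
  have E: "?E \<in> sets lebesgue"
    unfolding E_eq by (intro sets.Int meas contf continuous_intros) auto
  \<comment> \<open>Adding the two increment bounds cancels \<open>f\<close> and leaves the sum of
    the coefficients \<open>L + \<bar>\<alpha>\<bar>\<close> and
    \<open>L + \<bar>\<beta>\<bar>\<close>, which \<open>M\<close> dominates while being visibly
    positive.\<close>
  define M where "M = 2 * L + \<bar>\<alpha>\<bar> + \<bar>\<beta>\<bar> + 1"
  have "M > 0"
    using lipschitz_on_nonneg[OF lip] by (simp add: M_def)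
  show ?thesis
  proof (rule negligible_of_interval_deficit[OF E, of a b "(\<beta> - \<alpha>) / M"])
    fix u v :: real assume "u \<le> v"
    let ?m = "measure lebesgue ({u..v} - ?E)"
    have "f v - f u \<le> \<alpha> * (v - u) + (L + \<bar>\<alpha>\<bar>) * ?m"
      by (rule lipschitz_increment_le[OF \<open>u \<le> v\<close> lipschitz_on_subset[OF lip] \<sigma> E])
        (auto, metis less_imp_le)
    moreover have "- f v - - f u \<le> - \<beta> * (v - u) + (L + \<bar>- \<beta>\<bar>) * ?m"
    proof (rule lipschitz_increment_le[OF \<open>u \<le> v\<close> _ \<tau> E])
      show "L-lipschitz_on {u..v} (\<lambda>t. - f t)"
        using lipschitz_on_minus[OF lipschitz_on_subset[OF lip]] by auto
      fix t d :: real assume "t \<in> ?E" "d > 0"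
      then obtain h where "0 < h" "h < d" "\<beta> * h < \<tau> * (f (t + \<tau> * h) - f t)"
        by blast
      then show "\<exists>h>0. h < d \<and> \<tau> * (- f (t + \<tau> * h) - - f t) \<le> - \<beta> * h"
        by (intro exI[of _ h]) (auto simp: algebra_simps)
    qed
    ultimately have "(\<beta> - \<alpha>) * (v - u) \<le> (2 * L + \<bar>\<alpha>\<bar> + \<bar>\<beta>\<bar>) * ?m"
      by (simp add: algebra_simps)
    also have "\<dots> \<le> M * ?m"
      by (intro mult_right_mono) (auto simp: M_def)
    finally show "(\<beta> - \<alpha>) / M * (v - u) \<le> ?m"
      using \<open>M > 0\<close> by (simp add: field_simps)
  qed (use \<open>M > 0\<close> \<open>\<alpha> < \<beta>\<close> in auto)
qed

text \<open>If the difference quotients at \<open>t\<close> do not converge, two rationals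
  \<open>\<alpha> < \<beta>\<close> fit between their lower and upper limits, and each limit is
  approached from at least one side. The side combinations, rational pairs and bounded intervals are
  countable in number, and each contributes a null set by
  \<open>lipschitz_slope_gap_negligible\<close>.\<close>

lemma lipschitz_real_derivative_ae:
  fixes f :: "real \<Rightarrow> real"
  assumes lip: "L-lipschitz_on UNIV f"
  shows "\<exists>N. negligible N \<and> (\<forall>t. t \<notin> N \<longrightarrow> (\<exists>D. (f has_real_derivative D) (at t)))"
proof -
  define W where "W \<sigma> \<tau> \<alpha> \<beta> n = {t \<in> {- real n..real n}. (\<forall>d>0. \<exists>h. 0 < h \<and> h < d \<and> \<sigma> * (f (t + \<sigma> * h) - f t) < \<alpha> * h) \<and>
     (\<forall>d>0. \<exists>h. 0 < h \<and> h < d \<and> \<beta> * h < \<tau> * (f (t + \<tau> * h) - f t))}" for \<sigma> \<tau> \<alpha> \<beta> :: real and n :: nat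
  define I where "I = {(\<sigma> :: real, \<tau> :: real, \<alpha> :: real, \<beta>, n). \<sigma> \<in> {1, -1} \<and> \<tau> \<in> {1, -1} \<and> \<alpha> \<in> \<rat> \<and> \<beta> \<in> \<rat> \<and> \<alpha> < \<beta> \<and> n \<in> (UNIV :: nat set)}"
  define N where "N = (\<Union>(\<sigma>, \<tau>, \<alpha>, \<beta>, n)\<in>I. W \<sigma> \<tau> \<alpha> \<beta> n)"
  have "I \<subseteq> {1, -1} \<times> {1, -1} \<times> \<rat> \<times> \<rat> \<times> UNIV"
    by (auto simp: I_def)
  moreover have "countable ({1, -1::real} \<times> {1, -1::real} \<times> (\<rat> :: real set) \<times> (\<rat> :: real set) \<times> (UNIV :: nat set))"
    by (intro countable_SIGMA) (auto intro: countable_rat)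
  ultimately have "countable I"
    using countable_subset by blast
  moreover have "negligible (W \<sigma> \<tau> \<alpha> \<beta> n)" if "(\<sigma>, \<tau>, \<alpha>, \<beta>, n) \<in> I" for \<sigma> \<tau> \<alpha> \<beta> n
    unfolding W_def using that by (intro lipschitz_slope_gap_negligible[OF lip]) (auto simp: I_def)
  ultimately have "negligible N"
    unfolding N_def by (intro negligible_countable_Union countable_image) auto
  moreover have "\<exists>D. (f has_real_derivative D) (at t)" if "t \<notin> N" for t
  proof -
    define q where "q h = (f (t + h) - f t) / h" for h
    have q_le: "\<bar>q h\<bar> \<le> L" if "h \<noteq> 0" for h
      using lipschitz_onD[OF lip, of "t + h" t] that by (simp add: q_def dist_real_def field_simps)
    \<comment> \<open>The supremum \<open>D\<close> of \<open>A\<close> is the lower limit of the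
      quotients at \<open>0\<close>, hence the only candidate for the derivative.\<close>
    define A where "A = {\<alpha>. \<exists>d>0. \<forall>h. h \<noteq> 0 \<and> \<bar>h\<bar> < d \<longrightarrow> \<alpha> \<le> q h}"
    have "- L \<in> A"
      unfolding A_def using q_le by (auto simp: abs_le_iff intro!: exI[of _ 1]) (metis minus_le_iff)
    have bdd: "bdd_above A"
    proof (rule bdd_aboveI)
      fix \<alpha> assume "\<alpha> \<in> A"
      then obtain d where "d > 0" "\<forall>h. h \<noteq> 0 \<and> \<bar>h\<bar> < d \<longrightarrow> \<alpha> \<le> q h"
        by (auto simp: A_def)
      then show "\<alpha> \<le> L"
        using q_le[of "d / 2"] by (auto simp: abs_le_iff dest!: spec[of _ "d / 2"])
    qed
    define D where "D = Sup A"
    \<comment> \<open>A property that holds at points arbitrarily near \<open>0\<close> does so on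
      one fixed side; this turns two-sided quotients into the one-sided form with
      \<open>\<sigma>\<close> and \<open>\<tau>\<close>.\<close>
    have side: "\<exists>\<sigma>\<in>{1, -1}. \<forall>d>0. \<exists>h. 0 < h \<and> h < d \<and> P (\<sigma> * h)"
      if P: "\<And>d. d > 0 \<Longrightarrow> \<exists>h. h \<noteq> 0 \<and> \<bar>h\<bar> < d \<and> P h" for P :: "real \<Rightarrow> bool"
    proof (rule ccontr)
      assume "\<not> ?thesis"
      then obtain d e where de: "d > 0" "e > 0" "\<And>h. 0 < h \<Longrightarrow> h < d \<Longrightarrow> \<not> P h" "\<And>h. 0 < h \<Longrightarrow> h < e \<Longrightarrow> \<not> P (- h)"
        by auto
      then obtain h where "h \<noteq> 0" "\<bar>h\<bar> < min d e" "P h"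
        using P[of "min d e"] by (metis min_less_iff_conj)
      then show False
        using de(3)[of h] de(4)[of "- h"] by (cases "h > 0") auto
    qed
    have low: "\<exists>\<sigma>\<in>{1, -1}. \<forall>d>0. \<exists>h. 0 < h \<and> h < d \<and> \<sigma> * (f (t + \<sigma> * h) - f t) < \<alpha> * h" if "\<alpha> > D" for \<alpha>
    proof -
      have "\<alpha> \<notin> A"
        using that bdd cSup_upper by (fastforce simp: D_def)
      then have "\<exists>\<sigma>\<in>{1, -1}. \<forall>d>0. \<exists>h. 0 < h \<and> h < d \<and> q (\<sigma> * h) < \<alpha>"
        by (intro side) (auto simp: A_def not_le)
      then obtain \<sigma> where \<sigma>: "\<sigma> \<in> {1, -1::real}" "\<And>d. d > 0 \<Longrightarrow> \<exists>h. 0 < h \<and> h < d \<and> q (\<sigma> * h) < \<alpha>"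
        by blast
      have "\<sigma> * (f (t + \<sigma> * h) - f t) < \<alpha> * h" if "0 < h" "q (\<sigma> * h) < \<alpha>" for h
        using that \<sigma>(1) by (auto simp: q_def field_simps)
      then show ?thesis
        using \<sigma> by (meson)
    qed
    have "(q \<longlongrightarrow> D) (at 0)"
    proof (rule order_tendstoI)
      fix l assume "l < D"
      then obtain \<alpha> where "\<alpha> \<in> A" "l < \<alpha>"
        using \<open>- L \<in> A\<close> less_cSupE[of l A] by (metis D_def empty_iff)
      then obtain d where "d > 0" "\<And>h. h \<noteq> 0 \<Longrightarrow> \<bar>h\<bar> < d \<Longrightarrow> l < q h"
        unfolding A_def by force
      then show "\<forall>\<^sub>F h in at 0. l < q h"
        by (auto simp: eventually_at dist_real_def)
    next
      fix u assume "D < u"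
      then obtain \<beta> where \<beta>: "\<beta> \<in> \<rat>" "D < \<beta>" "\<beta> < u"
        using Rats_dense_in_real by blast
      then obtain \<alpha> where \<alpha>: "\<alpha> \<in> \<rat>" "D < \<alpha>" "\<alpha> < \<beta>"
        using Rats_dense_in_real by blast
      show "\<forall>\<^sub>F h in at 0. q h < u"
      proof (rule ccontr)
        assume "\<not> ?thesis"
        then have "\<exists>h. h \<noteq> 0 \<and> \<bar>h\<bar> < d \<and> \<beta> < q h" if "d > 0" for d
          using that \<beta>(3) unfolding eventually_at by (auto simp: dist_real_def not_less) (metis less_le_trans not_le)
        then have "\<exists>\<tau>\<in>{1, -1}. \<forall>d>0. \<exists>h. 0 < h \<and> h < d \<and> \<beta> < q (\<tau> * h)"
          by (rule side)
        then obtain \<tau> where \<tau>: "\<tau> \<in> {1, -1::real}" "\<And>d. d > 0 \<Longrightarrow> \<exists>h. 0 < h \<and> h < d \<and> \<beta> < q (\<tau> * h)"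
          by blast
        have "\<beta> * h < \<tau> * (f (t + \<tau> * h) - f t)" if "0 < h" "\<beta> < q (\<tau> * h)" for h
          using that \<tau>(1) by (auto simp: q_def field_simps)
        then have "\<forall>d>0. \<exists>h. 0 < h \<and> h < d \<and> \<beta> * h < \<tau> * (f (t + \<tau> * h) - f t)"
          using \<tau>(2) by meson
        moreover obtain \<sigma> where \<sigma>: "\<sigma> \<in> {1, -1::real}" "\<forall>d>0. \<exists>h. 0 < h \<and> h < d \<and> \<sigma> * (f (t + \<sigma> * h) - f t) < \<alpha> * h"
          using low[OF \<alpha>(2)] by blast
        moreover obtain n where "\<bar>t\<bar> \<le> real n"
          using real_arch_simple by blast
        ultimately have "t \<in> W \<sigma> \<tau> \<alpha> \<beta> n"
          by (auto simp: W_def abs_le_iff)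
        moreover have "(\<sigma>, \<tau>, \<alpha>, \<beta>, n) \<in> I"
          using \<sigma>(1) \<tau>(1) \<alpha> \<beta> by (simp add: I_def)
        ultimately show False
          using \<open>t \<notin> N\<close> unfolding N_def by blast
      qed
    qed
    then show ?thesis
      by (auto simp: DERIV_def q_def[abs_def])
  qed
  ultimately show ?thesis
    by blast
qed

lemma lipschitz_vector_derivative_ae:
  fixes f :: "real \<Rightarrow> 'a::euclidean_space"
  assumes lip: "L-lipschitz_on UNIV f"
  shows "\<exists>N. negligible N \<and> (\<forall>t. t \<notin> N \<longrightarrow> (\<exists>D. (f has_vector_derivative D) (at t)))"
proof -
  have "\<exists>N. negligible N \<and> (\<forall>t. t \<notin> N \<longrightarrow> (\<exists>D. ((\<lambda>t. f t \<bullet> b) has_real_derivative D) (at t)))" if "b \<in> Basis" for b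
  proof (rule lipschitz_real_derivative_ae[of L], rule lipschitz_onI)
    fix s t :: real
    have "\<bar>(f s - f t) \<bullet> b\<bar> \<le> norm (f s - f t)"
      using that by (rule Basis_le_norm)
    then show "dist (f s \<bullet> b) (f t \<bullet> b) \<le> L * dist s t"
      using lipschitz_onD[OF lip, of s t] by (simp add: dist_norm inner_diff_left)
  qed (rule lipschitz_on_nonneg[OF lip])
  then obtain N where N: "\<And>b. b \<in> Basis \<Longrightarrow> negligible (N b)"
    "\<And>b t. b \<in> Basis \<Longrightarrow> t \<notin> N b \<Longrightarrow> \<exists>D. ((\<lambda>t. f t \<bullet> b) has_real_derivative D) (at t)"
    by metis
  have "\<exists>D. (f has_vector_derivative D) (at t)" if "t \<notin> (\<Union>b\<in>Basis. N b)" for t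
  proof -
    have "\<forall>b\<in>Basis. \<exists>D. ((\<lambda>t. f t \<bullet> b) has_real_derivative D) (at t)"
      using N(2) that by blast
    then obtain D where D: "\<And>b. b \<in> Basis \<Longrightarrow> ((\<lambda>t. f t \<bullet> b) has_real_derivative D b) (at t)"
      by metis
    have "(f has_vector_derivative (\<Sum>b\<in>Basis. D b *\<^sub>R b)) (at t)"
      unfolding has_vector_derivative_def
    proof (subst has_derivative_componentwise_within, rule ballI)
      fix b :: 'a assume "b \<in> Basis"
      then show "((\<lambda>x. f x \<bullet> b) has_derivative (\<lambda>x. (x *\<^sub>R (\<Sum>b\<in>Basis. D b *\<^sub>R b)) \<bullet> b)) (at t)"
        using D[of b] by (simp add: has_field_derivative_def inner_sum_left_Basis mult.commute[of _ "D b"])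
    qed
    then show ?thesis by blast
  qed
  moreover have "negligible (\<Union>b\<in>Basis. N b)"
    using N(1) by (intro negligible_Union) auto
  ultimately show ?thesis
    by blast
qed

section \<open>Intersections of translated convex sets\<close>

text \<open>A unit vector polar to the cone cannot lie in the cone, since it would satisfy
  \<open>u \<bullet> u \<le> 0\<close>; so some constraint is violated at \<open>u\<close>.
  Compactness of the set of such \<open>u\<close> makes the violation uniform.\<close>

lemma polyhedral_polar_gap:
  fixes n :: "'i \<Rightarrow> 'a::euclidean_space"
  assumes "finite I"
  shows "\<exists>\<gamma>>0. \<forall>u. norm u = 1 \<and> (\<forall>y. (\<forall>j\<in>I. n j \<bullet> y \<le> 0) \<longrightarrow> u \<bullet> y \<le> 0) \<longrightarrow> (\<exists>j\<in>I. \<gamma> \<le> n j \<bullet> u)"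
proof -
  define K where "K = {u. norm u = 1 \<and> (\<forall>y. (\<forall>j\<in>I. n j \<bullet> y \<le> 0) \<longrightarrow> u \<bullet> y \<le> 0)}"
  define F where "F u = (\<Sum>j\<in>I. max 0 (n j \<bullet> u))" for u
  have K_eq: "K = sphere 0 1 \<inter> (\<Inter>y\<in>{y. \<forall>j\<in>I. n j \<bullet> y \<le> 0}. {u. u \<bullet> y \<le> 0})"
    by (auto simp: K_def)
  have "compact K"
    unfolding K_eq by (intro compact_Int_closed closed_INT ballI closed_Collect_le continuous_intros) auto
  have cont: "continuous_on K F"
    unfolding F_def by (intro continuous_intros)
  show ?thesis
  proof (cases "K = {}")
    case True
    then show ?thesis
      unfolding K_def by (intro exI[of _ 1]) auto
  next
    case False
    obtain u where u: "u \<in> K" "\<And>v. v \<in> K \<Longrightarrow> F u \<le> F v"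
      using continuous_attains_inf[OF \<open>compact K\<close> False cont] by blast
    have "\<not> (\<forall>j\<in>I. n j \<bullet> u \<le> 0)"
    proof
      assume "\<forall>j\<in>I. n j \<bullet> u \<le> 0"
      then have "u \<bullet> u \<le> 0" "norm u = 1"
        using u(1) by (auto simp: K_def)
      then show False
        by (simp add: dot_square_norm)
    qed
    then obtain i where i: "i \<in> I" "n i \<bullet> u > 0"
      by force
    have "n i \<bullet> u \<le> F u"
    proof -
      have "max 0 (n i \<bullet> u) \<le> F u"
        unfolding F_def using i \<open>finite I\<close> by (intro member_le_sum) auto
      then show ?thesis by simp
    qed
    then have "F u > 0"
      using i by simp
    have "card I > 0"
      using i \<open>finite I\<close> by (auto simp: card_gt_0_iff)
    \<comment> \<open>\<open>F\<close> adds up the positive parts of the violations; at least one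
      summand reaches the average, which is bounded below through the minimum
      \<open>F u\<close>.\<close>
    define \<gamma> where "\<gamma> = F u / real (card I)"
    have "\<gamma> > 0"
      using \<open>F u > 0\<close> \<open>card I > 0\<close> by (simp add: \<gamma>_def)
    moreover have "\<exists>j\<in>I. \<gamma> \<le> n j \<bullet> v" if "v \<in> K" for v
    proof (rule ccontr)
      assume "\<not> ?thesis"
      then have "max 0 (n j \<bullet> v) < \<gamma>" if "j \<in> I" for j
        using that \<open>\<gamma> > 0\<close> by auto
      then have "F v < (\<Sum>j\<in>I. \<gamma>)"
        unfolding F_def using i \<open>finite I\<close> by (intro sum_strict_mono) auto
      also have "\<dots> = F u"
        using \<open>card I > 0\<close> by (simp add: \<gamma>_def)
      finally show False
        using u(2)[OF that] by simp
    qed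
    ultimately show ?thesis
      unfolding K_def by blast
  qed
qed

text \<open>
  Let \<open>p\<close> be the projection of \<open>x\<close>. Then \<open>x - p\<close> is polar to the cone cut out by the constraints
  active at \<open>p\<close>, so one of these is violated at \<open>x\<close> in proportion to \<open>|x - p|\<close>. The constant is uniform
  because there are only finitely many active sets.
\<close>

lemma hoffman_bound:
  fixes n :: "'i \<Rightarrow> 'a::euclidean_space"
  assumes "finite J"
  obtains \<kappa> where "\<kappa> \<ge> 0"
    "\<And>\<beta> x \<epsilon>. \<exists>z. \<forall>j\<in>J. n j \<bullet> z \<le> \<beta> j \<Longrightarrow> \<epsilon> \<ge> 0 \<Longrightarrow> \<forall>j\<in>J. n j \<bullet> x \<le> \<beta> j + \<epsilon> \<Longrightarrow>
      \<exists>y. (\<forall>j\<in>J. n j \<bullet> y \<le> \<beta> j) \<and> norm (x - y) \<le> \<kappa> * \<epsilon>"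
proof -
  have "\<forall>I\<in>Pow J. \<exists>\<gamma>>0. \<forall>u. norm u = 1 \<and> (\<forall>y. (\<forall>j\<in>I. n j \<bullet> y \<le> 0) \<longrightarrow> u \<bullet> y \<le> 0) \<longrightarrow> (\<exists>j\<in>I. \<gamma> \<le> n j \<bullet> u)"
    using polyhedral_polar_gap assms finite_subset by blast
  then obtain \<gamma> where \<gamma>: "\<And>I. I \<in> Pow J \<Longrightarrow> \<gamma> I > 0"
    "\<And>I u. I \<in> Pow J \<Longrightarrow> norm u = 1 \<Longrightarrow> (\<And>y. (\<forall>j\<in>I. n j \<bullet> y \<le> 0) \<Longrightarrow> u \<bullet> y \<le> 0) \<Longrightarrow> \<exists>j\<in>I. \<gamma> I \<le> n j \<bullet> u"
    by metis
  define \<kappa> where "\<kappa> = (\<Sum>I\<in>Pow J. 1 / \<gamma> I)"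
  have \<kappa>: "1 / \<gamma> I \<le> \<kappa>" if "I \<in> Pow J" for I
    unfolding \<kappa>_def using that \<gamma>(1) assms by (intro member_le_sum) (auto intro: less_imp_le)
  have "\<kappa> \<ge> 0"
    unfolding \<kappa>_def using \<gamma>(1) by (intro sum_nonneg) (auto intro: less_imp_le)
  moreover have "\<exists>y. (\<forall>j\<in>J. n j \<bullet> y \<le> \<beta> j) \<and> norm (x - y) \<le> \<kappa> * \<epsilon>"
    if ne: "\<exists>z. \<forall>j\<in>J. n j \<bullet> z \<le> \<beta> j" and \<epsilon>: "\<epsilon> \<ge> 0" "\<forall>j\<in>J. n j \<bullet> x \<le> \<beta> j + \<epsilon>" for \<beta> x \<epsilon>
  proof -
    define S where "S = (\<Inter>j\<in>J. {y. n j \<bullet> y \<le> \<beta> j})"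
    have "closed S" "convex S" "S \<noteq> {}"
      using ne by (auto simp: S_def closed_halfspace_le convex_halfspace_le intro!: closed_INT convex_INT)
    define p where "p = closest_point S x"
    have "p \<in> S"
      unfolding p_def using \<open>closed S\<close> \<open>S \<noteq> {}\<close> by (rule closest_point_in_set)
    have "norm (x - p) \<le> \<kappa> * \<epsilon>"
    proof (cases "x = p")
      case True
      then show ?thesis using \<epsilon>(1) \<open>\<kappa> \<ge> 0\<close> by simp
    next
      case False
      define I where "I = {j\<in>J. n j \<bullet> p = \<beta> j}"
      have I: "I \<in> Pow J" by (auto simp: I_def)
      define u where "u = (1 / norm (x - p)) *\<^sub>R (x - p)"
      have "norm u = 1"
        using False by (simp add: u_def)
      moreover have "u \<bullet> y \<le> 0" if y: "\<forall>j\<in>I. n j \<bullet> y \<le> 0" for y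
      proof -
        \<comment> \<open>A short step from \<open>p\<close> along \<open>y\<close> stays in
          \<open>S\<close>: active constraints do not increase and inactive ones have slack. The
          projection inequality at \<open>p\<close> then shows that \<open>u\<close> is
          polar.\<close>
        have "\<forall>j\<in>J. \<exists>s>0. \<forall>r. 0 \<le> r \<and> r \<le> s \<longrightarrow> n j \<bullet> p + r * (n j \<bullet> y) \<le> \<beta> j"
        proof
          fix j assume "j \<in> J"
          show "\<exists>s>0. \<forall>r. 0 \<le> r \<and> r \<le> s \<longrightarrow> n j \<bullet> p + r * (n j \<bullet> y) \<le> \<beta> j"
          proof (cases "n j \<bullet> y \<le> 0")
            case True
            have "n j \<bullet> p + r * (n j \<bullet> y) \<le> \<beta> j" if "r \<ge> 0" for r
              using \<open>p \<in> S\<close> \<open>j \<in> J\<close> mult_nonneg_nonpos[OF that True] by (auto simp: S_def intro: add_mono[of _ "\<beta> j" _ 0, simplified])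
            then show ?thesis
              by (intro exI[of _ 1]) auto
          next
            case False
            then have "j \<notin> I" using y by auto
            then have lt: "n j \<bullet> p < \<beta> j"
              using \<open>p \<in> S\<close> \<open>j \<in> J\<close> by (force simp: S_def I_def)
            define s where "s = (\<beta> j - n j \<bullet> p) / (n j \<bullet> y)"
            have "s > 0" "n j \<bullet> p + s * (n j \<bullet> y) = \<beta> j"
              using lt False by (auto simp: s_def)
            moreover have "n j \<bullet> p + r * (n j \<bullet> y) \<le> n j \<bullet> p + s * (n j \<bullet> y)" if "r \<le> s" for r
              using that False by (intro add_left_mono mult_right_mono) auto
            ultimately show ?thesis
              by (intro exI[of _ s]) auto
          qed
        qed
        then obtain s where s: "\<And>j. j \<in> J \<Longrightarrow> s j > 0"
          "\<And>j r. j \<in> J \<Longrightarrow> 0 \<le> r \<Longrightarrow> r \<le> s j \<Longrightarrow> n j \<bullet> p + r * (n j \<bullet> y) \<le> \<beta> j"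
          by metis
        define r where "r = Min (insert 1 (s ` J))"
        have "r > 0"
          using s(1) assms by (auto simp: r_def)
        moreover have "r \<le> s j" if "j \<in> J" for j
          using that assms by (auto simp: r_def)
        ultimately have "p + r *\<^sub>R y \<in> S"
          using s(2) by (auto simp: S_def inner_add_right)
        then have "(x - p) \<bullet> (p + r *\<^sub>R y - p) \<le> 0"
          unfolding p_def using \<open>closed S\<close> \<open>convex S\<close> by (intro closest_point_dot)
        then have "(x - p) \<bullet> y \<le> 0"
          using \<open>r > 0\<close> by (simp add: mult_le_0_iff)
        then show ?thesis
          by (simp add: u_def divide_nonpos_nonneg)
      qed
      ultimately obtain j where j: "j \<in> I" "\<gamma> I \<le> n j \<bullet> u"
        using \<gamma>(2)[OF I] by blast
      have "\<gamma> I * norm (x - p) \<le> n j \<bullet> (x - p)"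
        using j(2) False unfolding u_def inner_scaleR_right by (simp add: field_simps)
      also have "\<dots> \<le> \<epsilon>"
        using j(1) bspec[OF \<epsilon>(2), of j] by (simp add: I_def inner_diff_right)
      finally have "norm (x - p) \<le> 1 / \<gamma> I * \<epsilon>"
        using \<gamma>(1)[OF I] by (simp add: field_simps)
      also have "\<dots> \<le> \<kappa> * \<epsilon>"
        using \<kappa>[OF I] \<epsilon>(1) by (rule mult_right_mono)
      finally show ?thesis .
    qed
    then show ?thesis
      using \<open>p \<in> S\<close> by (auto simp: S_def)
  qed
  ultimately show thesis
    by (rule that)
qed

text \<open>Translating a half-space alters only its right-hand side. All translated systems
  therefore share their normals, and one Hoffman constant serves every choice of
  translations.\<close>

lemma polyhedra_translates_lipschitz:
  fixes P :: "'i \<Rightarrow> 'a::euclidean_space set"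
  assumes "finite I" and poly: "\<And>i. i \<in> I \<Longrightarrow> polyhedron (P i)"
  obtains \<kappa> where "\<kappa> \<ge> 0"
    "\<And>a b x \<epsilon>. \<exists>z. \<forall>i\<in>I. z - b i \<in> P i \<Longrightarrow> \<epsilon> \<ge> 0 \<Longrightarrow> \<forall>i\<in>I. x - a i \<in> P i \<Longrightarrow>
      \<forall>i\<in>I. norm (a i - b i) \<le> \<epsilon> \<Longrightarrow> \<exists>y. (\<forall>i\<in>I. y - b i \<in> P i) \<and> norm (x - y) \<le> \<kappa> * \<epsilon>"
proof -
  have "\<forall>i\<in>I. \<exists>F. finite F \<and> P i = \<Inter>F \<and> (\<forall>h\<in>F. \<exists>a b. h = {x. a \<bullet> x \<le> b})"
    using poly unfolding polyhedron_def by metis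
  then obtain F where F: "\<And>i. i \<in> I \<Longrightarrow> finite (F i)" "\<And>i. i \<in> I \<Longrightarrow> P i = \<Inter>(F i)"
    "\<And>i h. i \<in> I \<Longrightarrow> h \<in> F i \<Longrightarrow> \<exists>a b. h = {x. a \<bullet> x \<le> b}"
    by metis
  define H where "H h ab \<longleftrightarrow> h = {x. fst ab \<bullet> x \<le> snd ab}" for h :: "'a set" and ab :: "'a \<times> real"
  define n where "n h = fst (SOME ab. H h ab)" for h
  define r where "r h = snd (SOME ab. H h ab)" for h
  have h_eq: "h = {x. n h \<bullet> x \<le> r h}" if ih: "i \<in> I" "h \<in> F i" for i h
  proof -
    have "\<exists>ab. H h ab"
      using F(3)[OF ih] by (auto simp: H_def)
    then have "H h (SOME ab. H h ab)"
      by (rule someI_ex)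
    then show ?thesis
      by (simp add: H_def n_def r_def)
  qed
  \<comment> \<open>Constraints are indexed by pairs because the same half-space may occur in
    several \<open>P i\<close>, which move by different vectors \<open>b i\<close>.\<close>
  define J where "J = Sigma I F"
  have "finite J"
    unfolding J_def using assms(1) F(1) by (rule finite_SigmaI)
  have P_iff: "(\<forall>i\<in>I. y - b i \<in> P i) \<longleftrightarrow> (\<forall>j\<in>J. n (snd j) \<bullet> y \<le> r (snd j) + n (snd j) \<bullet> b (fst j))" for y b
  proof -
    have "y - b i \<in> P i \<longleftrightarrow> (\<forall>h\<in>F i. n h \<bullet> y \<le> r h + n h \<bullet> b i)" if "i \<in> I" for i
    proof -
      have "y - b i \<in> h \<longleftrightarrow> n h \<bullet> y \<le> r h + n h \<bullet> b i" if "h \<in> F i" for h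
        by (subst h_eq[OF \<open>i \<in> I\<close> that]) (auto simp: inner_diff_right)
      then show ?thesis
        using F(2)[OF \<open>i \<in> I\<close>] by auto
    qed
    then show ?thesis
      by (auto simp: J_def)
  qed
  obtain \<kappa> where \<kappa>: "\<kappa> \<ge> 0" "\<And>\<beta> x \<epsilon>. (\<exists>z. \<forall>j\<in>J. n (snd j) \<bullet> z \<le> \<beta> j) \<Longrightarrow> \<epsilon> \<ge> 0 \<Longrightarrow>
     (\<forall>j\<in>J. n (snd j) \<bullet> x \<le> \<beta> j + \<epsilon>) \<Longrightarrow> \<exists>y. (\<forall>j\<in>J. n (snd j) \<bullet> y \<le> \<beta> j) \<and> norm (x - y) \<le> \<kappa> * \<epsilon>"
    by (rule hoffman_bound[OF \<open>finite J\<close>, of "\<lambda>j. n (snd j)"]) blast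
  define M where "M = (\<Sum>j\<in>J. norm (n (snd j)))"
  have M: "norm (n (snd j)) \<le> M" if "j \<in> J" for j
    unfolding M_def using that \<open>finite J\<close> by (intro member_le_sum) auto
  have "M \<ge> 0"
    unfolding M_def by (intro sum_nonneg) auto
  show thesis
  proof (rule that)
    show "0 \<le> \<kappa> * M"
      using \<open>M \<ge> 0\<close> \<kappa>(1) by simp
    fix a b :: "'i \<Rightarrow> 'a" and x :: 'a and \<epsilon> :: real
    assume ne: "\<exists>z. \<forall>i\<in>I. z - b i \<in> P i" and "\<epsilon> \<ge> 0" and x: "\<forall>i\<in>I. x - a i \<in> P i"
      and ab: "\<forall>i\<in>I. norm (a i - b i) \<le> \<epsilon>"
    have "n (snd j) \<bullet> x \<le> r (snd j) + n (snd j) \<bullet> b (fst j) + M * \<epsilon>" if "j \<in> J" for j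
    proof -
      have "fst j \<in> I"
        using that by (auto simp: J_def)
      have "n (snd j) \<bullet> x \<le> r (snd j) + n (snd j) \<bullet> a (fst j)"
        using x that P_iff by blast
      also have "n (snd j) \<bullet> a (fst j) = n (snd j) \<bullet> b (fst j) + n (snd j) \<bullet> (a (fst j) - b (fst j))"
        by (simp add: inner_diff_right)
      also have "n (snd j) \<bullet> (a (fst j) - b (fst j)) \<le> norm (n (snd j)) * norm (a (fst j) - b (fst j))"
        by (rule norm_cauchy_schwarz)
      also have "\<dots> \<le> M * \<epsilon>"
        using M[OF that] ab \<open>fst j \<in> I\<close> \<open>M \<ge> 0\<close> by (intro mult_mono) auto
      finally show ?thesis by simp
    qed
    then have "\<exists>y. (\<forall>j\<in>J. n (snd j) \<bullet> y \<le> r (snd j) + n (snd j) \<bullet> b (fst j)) \<and> norm (x - y) \<le> \<kappa> * (M * \<epsilon>)"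
      using ne \<open>\<epsilon> \<ge> 0\<close> \<open>M \<ge> 0\<close> unfolding P_iff by (intro \<kappa>(2)) auto
    then show "\<exists>y. (\<forall>i\<in>I. y - b i \<in> P i) \<and> norm (x - y) \<le> \<kappa> * M * \<epsilon>"
      unfolding P_iff by (simp add: mult.assoc)
  qed
qed

text \<open>
  Replacing the non-polyhedral sets by their affine hulls gives a polyhedral system, whose solutions
  depend on the translations in a Lipschitz way. A solution of that system near \<open>x\<close> is then moved towards
  one near the Slater point \<open>z\<close>, by a fraction proportional to the size of the perturbation.
\<close>

lemma intersection_translates_lipschitz:
  fixes C :: "'i \<Rightarrow> 'a::euclidean_space set"
  assumes "finite I" and convex: "\<And>i. i \<in> I \<Longrightarrow> convex (C i)"
    and slater: "\<And>i. i \<in> I \<Longrightarrow> polyhedron (C i) \<and> z - a\<^sub>0 i \<in> C i \<or> z - a\<^sub>0 i \<in> rel_interior (C i)"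
  obtains \<delta> \<kappa> where "\<delta> > 0" "\<kappa> \<ge> 0"
    "\<And>a b x \<epsilon>. \<forall>i\<in>I. norm (b i - a\<^sub>0 i) \<le> \<delta> \<Longrightarrow> \<exists>w. \<forall>i\<in>I. w - b i \<in> C i \<Longrightarrow> \<epsilon> \<ge> 0 \<Longrightarrow>
      \<forall>i\<in>I. x - a i \<in> C i \<Longrightarrow> \<forall>i\<in>I. norm (a i - b i) \<le> \<epsilon> \<Longrightarrow> norm x \<le> R \<Longrightarrow>
      \<exists>y. (\<forall>i\<in>I. y - b i \<in> C i) \<and> norm (x - y) \<le> \<kappa> * \<epsilon>"
proof -
  define Q where "Q i = (if z - a\<^sub>0 i \<in> rel_interior (C i) then affine hull C i else C i)" for i
  have Q: "C i \<subseteq> Q i" "polyhedron (Q i)" "convex (Q i)" if "i \<in> I" for i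
    using slater[OF that] convex[OF that] by (auto simp: Q_def hull_inc affine_imp_polyhedron affine_imp_convex)
  obtain \<kappa> where \<kappa>: "\<kappa> \<ge> 0" "\<And>a b x \<epsilon>. \<exists>z. \<forall>i\<in>I. z - b i \<in> Q i \<Longrightarrow> \<epsilon> \<ge> 0 \<Longrightarrow> \<forall>i\<in>I. x - a i \<in> Q i \<Longrightarrow>
    \<forall>i\<in>I. norm (a i - b i) \<le> \<epsilon> \<Longrightarrow> \<exists>y. (\<forall>i\<in>I. y - b i \<in> Q i) \<and> norm (x - y) \<le> \<kappa> * \<epsilon>"
    by (rule polyhedra_translates_lipschitz[OF \<open>finite I\<close> Q(2)]) blast+
  have "\<forall>i\<in>I. \<exists>e>0. cball (z - a\<^sub>0 i) e \<inter> Q i \<subseteq> C i"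
  proof
    fix i assume "i \<in> I"
    show "\<exists>e>0. cball (z - a\<^sub>0 i) e \<inter> Q i \<subseteq> C i"
      by (cases "z - a\<^sub>0 i \<in> rel_interior (C i)") (auto simp: Q_def mem_rel_interior_cball intro!: exI[of _ 1])
  qed
  then obtain e where e: "\<And>i. i \<in> I \<Longrightarrow> e i > 0" "\<And>i. i \<in> I \<Longrightarrow> cball (z - a\<^sub>0 i) (e i) \<inter> Q i \<subseteq> C i"
    by metis
  define r where "r = Min (insert 1 (e ` I)) / 2"
  have "r > 0"
    using e(1) \<open>finite I\<close> by (auto simp: r_def)
  have r: "cball (z - a\<^sub>0 i) (2 * r) \<inter> Q i \<subseteq> C i" if "i \<in> I" for i
  proof -
    have "2 * r \<le> e i"
      using that \<open>finite I\<close> by (auto simp: r_def)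
    then show ?thesis
      using e(2)[OF that] by (meson Int_mono order_refl order_trans subset_cball)
  qed
  \<comment> \<open>Chosen so that \<open>w - b i\<close>, with \<open>w\<close> within
    \<open>\<kappa> * \<delta>\<close> of \<open>z\<close>, lies within \<open>r\<close> of the
    Slater point \<open>z - a\<^sub>0 i\<close> relative to \<open>C i\<close>. The ball there has
    radius \<open>2 * r\<close>, so another \<open>r\<close> is left for a correction.\<close>
  define \<delta> where "\<delta> = r / (\<kappa> + 1)"
  have "\<delta> > 0" "(\<kappa> + 1) * \<delta> = r"
    using \<open>r > 0\<close> \<kappa>(1) by (auto simp: \<delta>_def)
  then have "\<kappa> * \<delta> + \<delta> = r"
    by (simp add: distrib_right)
  \<comment> \<open>The first summand pays for reaching \<open>v\<close>, the second for moving a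
    fraction of at most \<open>\<eta> / r\<close> towards \<open>w\<close>, over a distance of at
    most \<open>norm z + r + \<bar>R\<bar>\<close>. This is where the bound on \<open>norm x\<close>
    enters.\<close>
  define \<kappa>' where "\<kappa>' = \<kappa> + (\<kappa> + 1) * (norm z + r + \<bar>R\<bar>) / r"
  have "\<kappa>' \<ge> 0"
    using \<kappa>(1) \<open>r > 0\<close> by (simp add: \<kappa>'_def)
  show thesis
  proof (rule that[OF \<open>\<delta> > 0\<close> \<open>\<kappa>' \<ge> 0\<close>])
    fix a b :: "'i \<Rightarrow> 'a" and x :: 'a and \<epsilon> :: real
    assume b: "\<forall>i\<in>I. norm (b i - a\<^sub>0 i) \<le> \<delta>" and ne: "\<exists>w. \<forall>i\<in>I. w - b i \<in> C i" and "\<epsilon> \<ge> 0"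
      and x: "\<forall>i\<in>I. x - a i \<in> C i" and ab: "\<forall>i\<in>I. norm (a i - b i) \<le> \<epsilon>" and "norm x \<le> R"
    show "\<exists>y. (\<forall>i\<in>I. y - b i \<in> C i) \<and> norm (x - y) \<le> \<kappa>' * \<epsilon>"
    proof (cases "\<epsilon> = 0")
      case True
      then have "\<forall>i\<in>I. a i = b i"
        using ab by auto
      then show ?thesis
        using x True by (intro exI[of _ x]) auto
    next
      case False
      then have "\<epsilon> > 0" using \<open>\<epsilon> \<ge> 0\<close> by simp
      have neQ: "\<exists>w. \<forall>i\<in>I. w - b i \<in> Q i"
        using ne Q(1) by blast
      have zQ: "\<forall>i\<in>I. z - a\<^sub>0 i \<in> Q i"
        using slater rel_interior_subset Q(1) by blast
      obtain w where w: "\<forall>i\<in>I. w - b i \<in> Q i" "norm (z - w) \<le> \<kappa> * \<delta>"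
        using \<kappa>(2)[OF neQ _ zQ, of \<delta>] b \<open>\<delta> > 0\<close> by (auto simp: norm_minus_commute)
      obtain v where v: "\<forall>i\<in>I. v - b i \<in> Q i" "norm (x - v) \<le> \<kappa> * \<epsilon>"
        using \<kappa>(2)[OF neQ \<open>\<epsilon> \<ge> 0\<close> _ ab, of x] x Q(1) by blast
      define \<eta> where "\<eta> = (\<kappa> + 1) * \<epsilon>"
      have "\<eta> > 0" using \<open>\<epsilon> > 0\<close> \<kappa>(1) by (simp add: \<eta>_def)
      \<comment> \<open>\<open>\<eta>\<close> bounds the distance of \<open>v - b i\<close> from the
        point \<open>x - a i\<close> of \<open>C i\<close>. With this \<open>l\<close>, that defect,
        weighted by \<open>1 - l\<close>, is exactly the room \<open>r\<close> around
        \<open>w - b i\<close>, weighted by \<open>l\<close>.\<close>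
      define l where "l = \<eta> / (\<eta> + r)"
      have l: "0 < l" "l < 1" "l \<le> \<eta> / r" "(1 - l) * \<eta> = l * r"
        using \<open>\<eta> > 0\<close> \<open>r > 0\<close> by (auto simp: l_def field_simps)
      define y where "y = (1 - l) *\<^sub>R v + l *\<^sub>R w"
      have "y - b i \<in> C i" if "i \<in> I" for i
      proof (cases "z - a\<^sub>0 i \<in> rel_interior (C i)")
        case False
        then have "v - b i \<in> C i" "w - b i \<in> C i"
          using v(1) w(1) that by (auto simp: Q_def)
        then have "(1 - l) *\<^sub>R (v - b i) + l *\<^sub>R (w - b i) \<in> C i"
          using l convex[OF that] by (intro convexD_alt) auto
        then show ?thesis
          by (simp add: y_def algebra_simps)
      next
        case True
        then have aff: "Q i = affine hull C i" by (simp add: Q_def)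
        define k where "k = (v - b i) - (x - a i)"
        have "norm k \<le> \<eta>"
        proof -
          have "k = - (x - v) + (a i - b i)"
            by (simp add: k_def)
          then have "norm k \<le> norm (x - v) + norm (a i - b i)"
            by (metis norm_minus_cancel norm_triangle_ineq)
          then show ?thesis
            using v(2) ab that by (fastforce simp: \<eta>_def distrib_right)
        qed
        define s where "s = (1 - l) / l"
        \<comment> \<open>The defect \<open>k\<close> is transferred from \<open>v - b i\<close> to
          \<open>w - b i\<close>, where there is room for it. So \<open>y - b i\<close> becomes a
          convex combination of \<open>x - a i\<close> and \<open>q\<close>, both in
          \<open>C i\<close>.\<close>
        define q where "q = (w - b i) + s *\<^sub>R k"
        have "s \<ge> 0"
          using l by (simp add: s_def)
        have "s * \<eta> = r"
          using l by (simp add: s_def field_simps)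
        have "q \<in> Q i"
        proof -
          have "w - b i \<in> Q i" "v - b i \<in> Q i" "x - a i \<in> Q i"
            using w(1) v(1) x Q(1) that by blast+
          moreover have "affine (Q i)"
            by (simp add: aff)
          ultimately show ?thesis
            unfolding q_def k_def using mem_affine_3_minus by blast
        qed
        moreover have "norm (q - (z - a\<^sub>0 i)) \<le> 2 * r"
        proof -
          have "q - (z - a\<^sub>0 i) = - (z - w) + (- (b i - a\<^sub>0 i) + s *\<^sub>R k)"
            by (simp add: q_def algebra_simps)
          then have "norm (q - (z - a\<^sub>0 i)) \<le> norm (z - w) + (norm (b i - a\<^sub>0 i) + norm (s *\<^sub>R k))"
            by (metis norm_minus_cancel norm_triangle_mono norm_triangle_ineq order_refl)
          also have "norm (s *\<^sub>R k) \<le> s * \<eta>"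
            using \<open>norm k \<le> \<eta>\<close> \<open>s \<ge> 0\<close> by (simp add: mult_left_mono)
          finally show ?thesis
            using w(2) b that \<open>\<kappa> * \<delta> + \<delta> = r\<close> \<open>s * \<eta> = r\<close> by fastforce
        qed
        ultimately have "q \<in> C i"
          using r[OF that] by (auto simp: dist_norm norm_minus_commute)
        then have "(1 - l) *\<^sub>R (x - a i) + l *\<^sub>R q \<in> C i"
          using l convex[OF that] x that by (intro convexD_alt) auto
        moreover have "(1 - l) *\<^sub>R (x - a i) + l *\<^sub>R q = y - b i"
        proof -
          have "l *\<^sub>R q = l *\<^sub>R (w - b i) + (1 - l) *\<^sub>R k"
            using l by (simp add: q_def s_def scaleR_add_right)
          then show ?thesis
            by (simp add: k_def y_def algebra_simps)
        qed
        ultimately show ?thesis by simp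
      qed
      moreover have "norm (x - y) \<le> \<kappa>' * \<epsilon>"
      proof -
        have "x - y = (1 - l) *\<^sub>R (x - v) + l *\<^sub>R (x - w)"
          by (simp add: y_def algebra_simps)
        then have "norm (x - y) \<le> (1 - l) * norm (x - v) + l * norm (x - w)"
          using l by (metis norm_triangle_ineq norm_scaleR abs_of_nonneg diff_ge_0_iff_ge less_imp_le)
        also have "\<dots> \<le> norm (x - v) + l * norm (x - w)"
          using l by (simp add: mult_left_le_one_le)
        also have "norm (x - w) \<le> norm z + r + \<bar>R\<bar>"
        proof -
          have "x - w = x + (- z + (z - w))" by simp
          then have "norm (x - w) \<le> norm x + (norm z + norm (z - w))"
            by (metis norm_minus_cancel norm_triangle_mono norm_triangle_ineq order_refl)
          moreover have "\<kappa> * \<delta> \<le> r"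
            using \<open>\<kappa> * \<delta> + \<delta> = r\<close> \<open>\<delta> > 0\<close> by linarith
          ultimately show ?thesis
            using w(2) \<open>norm x \<le> R\<close> by linarith
        qed
        then have "l * norm (x - w) \<le> \<eta> / r * (norm z + r + \<bar>R\<bar>)"
          using l \<open>\<eta> > 0\<close> \<open>r > 0\<close> by (intro mult_mono) auto
        also have "\<dots> = (\<kappa> + 1) * (norm z + r + \<bar>R\<bar>) / r * \<epsilon>"
          by (simp add: \<eta>_def)
        finally show ?thesis
          using v(2) by (simp add: \<kappa>'_def distrib_right)
      qed
      ultimately show ?thesis by blast
    qed
  qed
qed

section \<open>Lipschitz dependence on time, uniformly over a period\<close>

lemma periodic_add_of_int_mult:
  fixes f :: "real \<Rightarrow> 'b"
  assumes per: "\<And>t. f (t + T) = f t"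
  shows "f (t + of_int n * T) = f t"
proof -
  have nat: "f (s + of_nat m * T) = f s" for s m
  proof (induction m)
    case (Suc m)
    have "f (s + of_nat (Suc m) * T) = f ((s + of_nat m * T) + T)"
      by (simp add: algebra_simps)
    then show ?case
      using per Suc by simp
  qed simp
  show ?thesis
  proof (cases "n \<ge> 0")
    case True
    then show ?thesis
      using nat[of t "nat n"] by simp
  next
    case False
    then show ?thesis
      using nat[of "t + of_int n * T" "nat (- n)"] by simp
  qed
qed

lemma exists_int_shift_into_period:
  fixes t T :: real
  assumes "T > 0"
  obtains n :: int where "t + of_int n * T \<in> {0..T}"
proof (rule that)
  define n where "n = - \<lfloor>t / T\<rfloor>"
  have "0 \<le> t / T + of_int n" "t / T + of_int n \<le> 1"
    by (simp_all add: n_def) linarith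
  moreover have "t + of_int n * T = (t / T + of_int n) * T"
    using \<open>T > 0\<close> by (simp add: algebra_simps)
  ultimately show "t + of_int n * T \<in> {0..T}"
    using \<open>T > 0\<close> mult_right_mono[of "t / T + of_int n" 1 T] by simp
qed

text \<open>The Slater point at \<open>t0\<close> gives a constant valid for all target times
  \<open>t\<close> near \<open>t0\<close> and for every source time \<open>s\<close>. Finitely many
  \<open>t0\<close> cover one period. Shifting both times by the same multiple of \<open>T\<close>
  brings \<open>t\<close> into that period; \<open>s\<close> may remain outside.\<close>

lemma intersection_translates_hausdorff_lipschitz:
  fixes C :: "'i \<Rightarrow> 'a::euclidean_space set"
  assumes "finite I" and convex: "\<And>i. i \<in> I \<Longrightarrow> convex (C i)" and "T > 0"
    and slater: "\<And>t. \<exists>z. \<forall>i\<in>I. polyhedron (C i) \<and> z - c i t \<in> C i \<or> z - c i t \<in> rel_interior (C i)"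
    and lip: "\<And>i. i \<in> I \<Longrightarrow> \<exists>L. L-lipschitz_on UNIV (c i)"
    and D: "\<And>t z. z \<in> D t \<longleftrightarrow> (\<forall>i\<in>I. z - c i t \<in> C i)"
    and bdd: "\<And>t. D t \<subseteq> cball 0 R"
    and per: "\<And>t (n::int). D (t + of_int n * T) = D t"
  obtains \<kappa> where "\<kappa> \<ge> 0" "\<And>s t z. z \<in> D s \<Longrightarrow> \<exists>y\<in>D t. norm (z - y) \<le> \<kappa> * \<bar>s - t\<bar>"
proof -
  obtain Li where Li: "\<And>i. i \<in> I \<Longrightarrow> (Li i)-lipschitz_on UNIV (c i)"
    using lip by metis
  define L where "L = (\<Sum>i\<in>I. Li i)"
  have "L \<ge> 0"
    unfolding L_def using lipschitz_on_nonneg[OF Li] by (rule sum_nonneg)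
  have L: "norm (c i s - c i t) \<le> L * \<bar>s - t\<bar>" if "i \<in> I" for i s t
  proof -
    have "norm (c i s - c i t) \<le> Li i * \<bar>s - t\<bar>"
      using lipschitz_onD[OF Li[OF that], of s t] by (simp add: dist_norm)
    also have "\<dots> \<le> L * \<bar>s - t\<bar>"
      unfolding L_def using that \<open>finite I\<close> lipschitz_on_nonneg[OF Li] by (intro mult_right_mono member_le_sum) auto
    finally show ?thesis .
  qed
  have ne: "D t \<noteq> {}" for t
    using slater[of t] rel_interior_subset by (fastforce simp: D)
  have "\<exists>r \<kappa>. r > 0 \<and> \<kappa> \<ge> 0 \<and> (\<forall>t\<in>ball t0 r. \<forall>s. \<forall>z\<in>D s. \<exists>y\<in>D t. norm (z - y) \<le> \<kappa> * \<bar>s - t\<bar>)" for t0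
  proof -
    obtain z where z: "\<And>i. i \<in> I \<Longrightarrow> polyhedron (C i) \<and> z - c i t0 \<in> C i \<or> z - c i t0 \<in> rel_interior (C i)"
      using slater[of t0] by auto
    obtain \<delta> \<kappa> where "\<delta> > 0" "\<kappa> \<ge> 0" and reg:
      "\<And>a b x \<epsilon>. \<forall>i\<in>I. norm (b i - c i t0) \<le> \<delta> \<Longrightarrow> \<exists>w. \<forall>i\<in>I. w - b i \<in> C i \<Longrightarrow> \<epsilon> \<ge> 0 \<Longrightarrow>
      \<forall>i\<in>I. x - a i \<in> C i \<Longrightarrow> \<forall>i\<in>I. norm (a i - b i) \<le> \<epsilon> \<Longrightarrow> norm x \<le> R \<Longrightarrow>
      \<exists>y. (\<forall>i\<in>I. y - b i \<in> C i) \<and> norm (x - y) \<le> \<kappa> * \<epsilon>"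
      by (rule intersection_translates_lipschitz[where C = C and z = z and a\<^sub>0 = "\<lambda>i. c i t0" and R = R,
            OF \<open>finite I\<close> convex z]) blast+
    have near: "\<forall>i\<in>I. norm (c i t - c i t0) \<le> \<delta>" if "t \<in> ball t0 (\<delta> / (L + 1))" for t
    proof
      fix i assume "i \<in> I"
      have "\<bar>t - t0\<bar> \<le> \<delta> / (L + 1)"
        using that by (simp add: dist_real_def)
      then have "L * \<bar>t - t0\<bar> \<le> (L + 1) * (\<delta> / (L + 1))"
        using \<open>L \<ge> 0\<close> \<open>\<delta> > 0\<close> by (intro mult_mono) auto
      also have "\<dots> = \<delta>"
        using \<open>L \<ge> 0\<close> by simp
      finally show "norm (c i t - c i t0) \<le> \<delta>"
        using L[OF \<open>i \<in> I\<close>, of t t0] by linarith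
    qed
    have "\<exists>y\<in>D t. norm (z - y) \<le> \<kappa> * L * \<bar>s - t\<bar>" if t: "t \<in> ball t0 (\<delta> / (L + 1))" and z: "z \<in> D s" for s t z
    proof -
      have "\<exists>w. \<forall>i\<in>I. w - c i t \<in> C i" "\<forall>i\<in>I. z - c i s \<in> C i" "norm z \<le> R"
        using ne[of t] z bdd[of s] by (auto simp flip: D)
      then obtain y where "\<forall>i\<in>I. y - c i t \<in> C i" "norm (z - y) \<le> \<kappa> * (L * \<bar>s - t\<bar>)"
        using reg[OF near[OF t], of "L * \<bar>s - t\<bar>" z "\<lambda>i. c i s"] L \<open>L \<ge> 0\<close> by auto
      then show ?thesis
        by (intro bexI[of _ y]) (auto simp: D mult.assoc)
    qed
    then show ?thesis
      using \<open>\<delta> > 0\<close> \<open>\<kappa> \<ge> 0\<close> \<open>L \<ge> 0\<close> by (intro exI[of _ "\<delta> / (L + 1)"] exI[of _ "\<kappa> * L"]) auto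
  qed
  then obtain r \<kappa> where r: "\<And>t0. r t0 > 0" and \<kappa>: "\<And>t0. \<kappa> t0 \<ge> 0"
    "\<And>t0 t s z. t \<in> ball t0 (r t0) \<Longrightarrow> z \<in> D s \<Longrightarrow> \<exists>y\<in>D t. norm (z - y) \<le> \<kappa> t0 * \<bar>s - t\<bar>"
    by metis
  obtain F where F: "F \<subseteq> {0..T}" "finite F" "{0..T} \<subseteq> (\<Union>t0\<in>F. ball t0 (r t0))"
  proof (rule compactE_image[of "{0..T}" "{0..T}" "\<lambda>t0. ball t0 (r t0)"])
    show "{0..T} \<subseteq> (\<Union>t0\<in>{0..T}. ball t0 (r t0))"
      using r by (auto intro!: bexI)
  qed auto
  define k where "k = (\<Sum>t0\<in>F. \<kappa> t0)"
  have k: "\<kappa> t0 \<le> k" if "t0 \<in> F" for t0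
    unfolding k_def using that F(2) \<kappa>(1) by (intro member_le_sum) auto
  show thesis
  proof (rule that)
    show "k \<ge> 0"
      unfolding k_def using \<kappa>(1) by (intro sum_nonneg) auto
    fix s t z assume "z \<in> D s"
    obtain n where n: "t + of_int n * T \<in> {0..T}"
      using exists_int_shift_into_period[OF \<open>T > 0\<close>] .
    define t' s' where "t' = t + of_int n * T" and "s' = s + of_int n * T"
    obtain t0 where t0: "t0 \<in> F" "t' \<in> ball t0 (r t0)"
      using F(3) n unfolding t'_def by blast
    have "z \<in> D s'"
      using \<open>z \<in> D s\<close> by (simp add: s'_def per)
    then obtain y where y: "y \<in> D t'" "norm (z - y) \<le> \<kappa> t0 * \<bar>s' - t'\<bar>"
      using \<kappa>(2)[OF t0(2)] by blast
    have "\<kappa> t0 * \<bar>s' - t'\<bar> \<le> k * \<bar>s - t\<bar>"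
      using k[OF t0(1)] by (simp add: s'_def t'_def mult_right_mono)
    then show "\<exists>y\<in>D t. norm (z - y) \<le> k * \<bar>s - t\<bar>"
      using y by (intro bexI[of _ y]) (auto simp: t'_def per)
  qed
qed

section \<open>Existence of solutions\<close>

lemma AE_lborel_iff_negligible:
  "(AE t in lborel. P t) \<longleftrightarrow> (\<exists>N. negligible N \<and> (\<forall>t. t \<notin> N \<longrightarrow> P t))"
proof
  assume "AE t in lborel. P t"
  then have "AE t in lebesgue. P t"
    by (simp add: AE_completion_iff)
  then obtain N where "N \<in> null_sets lebesgue" "{t \<in> space lebesgue. \<not> P t} \<subseteq> N"
    unfolding eventually_ae_filter by blast
  then show "\<exists>N. negligible N \<and> (\<forall>t. t \<notin> N \<longrightarrow> P t)"
    by (auto simp: negligible_iff_null_sets)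
next
  assume "\<exists>N. negligible N \<and> (\<forall>t. t \<notin> N \<longrightarrow> P t)"
  then obtain N where "N \<in> null_sets lebesgue" "\<And>t. t \<notin> N \<Longrightarrow> P t"
    by (auto simp: negligible_iff_null_sets)
  then have "AE t in lebesgue. P t"
    by (intro AE_I'[of N]) auto
  then show "AE t in lborel. P t"
    by (simp add: AE_completion_iff)
qed

lemma has_vector_derivative_inner_real:
  fixes f :: "real \<Rightarrow> 'a::euclidean_space"
  assumes "(f has_vector_derivative v) (at t)"
  shows "((\<lambda>s. f s \<bullet> w) has_real_derivative v \<bullet> w) (at t)"
  using bounded_linear.has_vector_derivative[OF bounded_linear_inner_left assms]
  by (simp add: has_real_derivative_iff_has_vector_derivative)

text \<open>Pointwise limits replace a uniformly convergent subsequence because the approximations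
  are step functions and not equicontinuous. In a finite subfamily the smallest index gives a common
  element, so the finite intersection property is immediate.\<close>

lemma decreasing_closed_pointwise_inter:
  fixes A :: "real \<Rightarrow> (real \<Rightarrow> 'a::euclidean_space) set"
  assumes "\<eta> > 0" and closed: "\<And>h. 0 < h \<Longrightarrow> h \<le> \<eta> \<Longrightarrow> closed (A h)"
    and ne: "\<And>h. 0 < h \<Longrightarrow> h \<le> \<eta> \<Longrightarrow> A h \<noteq> {}"
    and bdd: "\<And>h f t. f \<in> A h \<Longrightarrow> f t \<in> cball 0 R"
    and mono: "\<And>h h'. h \<le> h' \<Longrightarrow> A h \<subseteq> A h'"
  shows "\<exists>f. \<forall>h. 0 < h \<and> h \<le> \<eta> \<longrightarrow> f \<in> A h"
proof -
  let ?S = "PiE UNIV (\<lambda>_. cball 0 R) :: (real \<Rightarrow> 'a) set"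
  have "compactin (product_topology (\<lambda>_. euclidean) UNIV) ?S"
    by (simp add: compactin_PiE)
  then have "compact ?S"
    by (simp add: euclidean_product_topology flip: compactin_euclidean_iff)
  then have "?S \<inter> (\<Inter>h\<in>{0<..\<eta>}. A h) \<noteq> {}"
  proof (rule compact_imp_fip_image)
    show "closed (A h)" if "h \<in> {0<..\<eta>}" for h
      using that closed by simp
    fix I' assume I': "finite I'" "I' \<subseteq> {0<..\<eta>}"
    define h where "h = Min (insert \<eta> I')"
    have h: "0 < h" "h \<le> \<eta>" "\<And>i. i \<in> I' \<Longrightarrow> h \<le> i"
      using I' \<open>\<eta> > 0\<close> by (auto simp: h_def)
    then obtain f where "f \<in> A h"
      using ne by blast
    then have "f \<in> ?S \<inter> (\<Inter>h\<in>I'. A h)"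
      using bdd mono[OF h(3)] by (auto simp: PiE_def; blast)
    then show "?S \<inter> (\<Inter>h\<in>I'. A h) \<noteq> {}"
      by blast
  qed
  then obtain f where "f \<in> (\<Inter>h\<in>{0<..\<eta>}. A h)"
    by blast
  then show ?thesis
    by (intro exI[of _ f]) simp
qed

lemma le_at_zero_rightI:
  fixes G :: "real \<Rightarrow> real"
  assumes "\<eta> > 0" "\<And>h. 0 < h \<Longrightarrow> h \<le> \<eta> \<Longrightarrow> a \<le> G h" "isCont G 0"
  shows "a \<le> G 0"
proof (rule tendsto_lowerbound)
  show "(G \<longlongrightarrow> G 0) (at_right 0)"
    using assms(3) by (simp add: isCont_def filterlim_at_split)
  show "\<forall>\<^sub>F h in at_right 0. a \<le> G h"
    using assms(1,2) by (auto simp: eventually_at_right_field intro!: exI[of _ \<eta>])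
qed simp

context
  fixes C :: "real \<Rightarrow> 'a::euclidean_space set" and R \<kappa> \<eta> :: real and x0 :: 'a
  assumes closed_C: "\<And>t. closed (C t)" and convex_C: "\<And>t. convex (C t)"
    and ne_C: "\<And>t. C t \<noteq> {}" and bdd_C: "\<And>t. C t \<subseteq> cball 0 R"
    and \<eta>: "\<eta> > 0" and \<kappa>: "\<kappa> \<ge> 0"
    and lip_C: "\<And>s t x. \<bar>s - t\<bar> \<le> \<eta> \<Longrightarrow> x \<in> C s \<Longrightarrow> \<exists>y\<in>C t. norm (x - y) \<le> \<kappa> * \<bar>s - t\<bar>"
    and x0: "x0 \<in> C 0"
begin

primrec catch_up :: "real \<Rightarrow> nat \<Rightarrow> 'a" where
  "catch_up h 0 = x0"
| "catch_up h (Suc j) = closest_point (C (real (Suc j) * h)) (catch_up h j)"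

context
  fixes h :: real
  assumes h: "0 < h" "h \<le> \<eta>"
begin

lemma catch_up_mem: "catch_up h j \<in> C (real j * h)"
proof (induction j)
  case (Suc j)
  have "\<bar>real j * h - real (Suc j) * h\<bar> = h"
    using h by (simp add: algebra_simps)
  then have "C (real (Suc j) * h) \<noteq> {}"
    using lip_C[of "real j * h" "real (Suc j) * h", OF _ Suc] h by auto
  then show ?case
    using closest_point_in_set[OF closed_C] by simp
qed (simp add: x0)

lemma catch_up_step: "norm (catch_up h (Suc j) - catch_up h j) \<le> \<kappa> * h"
proof -
  have "\<bar>real j * h - real (Suc j) * h\<bar> = h"
    using h by (simp add: algebra_simps)
  then obtain y where y: "y \<in> C (real (Suc j) * h)" "norm (catch_up h j - y) \<le> \<kappa> * h"
    using lip_C[of "real j * h" "real (Suc j) * h", OF _ catch_up_mem] h by auto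
  have "dist (catch_up h j) (catch_up h (Suc j)) \<le> dist (catch_up h j) y"
    using closest_point_le[OF closed_C y(1)] by simp
  then show ?thesis
    using y(2) by (simp add: dist_norm norm_minus_commute)
qed

lemma catch_up_dist: "j \<le> m \<Longrightarrow> norm (catch_up h m - catch_up h j) \<le> \<kappa> * (real m * h - real j * h)"
proof (induction m rule: dec_induct)
  case (step m)
  have "norm (catch_up h (Suc m) - catch_up h j) \<le> norm (catch_up h (Suc m) - catch_up h m) + norm (catch_up h m - catch_up h j)"
    by (rule norm_diff_triangle_le[OF order_refl order_refl])
  also have "\<dots> \<le> \<kappa> * h + \<kappa> * (real m * h - real j * h)"
    using catch_up_step step.IH by (rule add_mono)
  finally show ?case
    by (simp add: algebra_simps)
qed simp

text \<open>A discrete variational inequality over several steps. The projection inequality of each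
  step is tested with a point \<open>c'\<close> near \<open>c\<close> in the set of that later time.
  Replacing \<open>c - catch_up h j\<close> by \<open>c' - catch_up h (Suc m)\<close> costs at most
  \<open>2 * \<kappa> * (\<delta> + h)\<close> in norm, times the step length
  \<open>\<kappa> * h\<close>; these costs add up to elapsed time times the last factor.\<close>

lemma catch_up_variational:
  assumes "0 \<le> \<delta>" "\<delta> \<le> \<eta>" "c \<in> C t" "real j * h \<le> t" "t < real j * h + h" "j \<le> m" "real m * h \<le> t + \<delta>"
  shows "(catch_up h j - catch_up h m) \<bullet> (c - catch_up h j) \<le> (real m * h - real j * h) * (2 * \<kappa>\<^sup>2 * (\<delta> + h))"
  using \<open>j \<le> m\<close> \<open>real m * h \<le> t + \<delta>\<close>
proof (induction m rule: dec_induct)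
  case (step m)
  let ?x = "catch_up h"
  have le: "real m * h \<le> t + \<delta>" "t \<le> real (Suc m) * h"
  proof -
    have "real j * h \<le> real m * h"
      using step.hyps h by (intro mult_right_mono) auto
    moreover have "real (Suc m) * h = real m * h + h"
      by (simp add: algebra_simps)
    ultimately show "real m * h \<le> t + \<delta>" "t \<le> real (Suc m) * h"
      using step.prems assms(4,5) h by linarith+
  qed
  then have "\<bar>t - real (Suc m) * h\<bar> \<le> \<delta>"
    using step.prems by auto
  then obtain c' where c': "c' \<in> C (real (Suc m) * h)" "norm (c - c') \<le> \<kappa> * \<bar>t - real (Suc m) * h\<bar>"
    using lip_C[of t "real (Suc m) * h" c] assms(2,3) by auto
  have "norm (c - c') \<le> \<kappa> * \<delta>"
    using c'(2) mult_left_mono[OF \<open>\<bar>t - real (Suc m) * h\<bar> \<le> \<delta>\<close> \<kappa>] by linarith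
  moreover have "norm (?x (Suc m) - ?x j) \<le> \<kappa> * (\<delta> + h)"
  proof -
    have "norm (?x (Suc m) - ?x j) \<le> \<kappa> * (real (Suc m) * h - real j * h)"
      using step.hyps by (intro catch_up_dist) simp
    also have "\<dots> \<le> \<kappa> * (\<delta> + h)"
      using step.prems assms(5) \<kappa> by (intro mult_left_mono) auto
    finally show ?thesis .
  qed
  ultimately have "norm ((c - c') + (?x (Suc m) - ?x j)) \<le> \<kappa> * \<delta> + \<kappa> * (\<delta> + h)"
    by (rule norm_triangle_mono)
  also have "\<dots> \<le> 2 * \<kappa> * (\<delta> + h)"
    using \<kappa> h by (simp add: algebra_simps)
  finally have far: "norm ((c - c') + (?x (Suc m) - ?x j)) \<le> 2 * \<kappa> * (\<delta> + h)" .
  have "(?x m - ?x (Suc m)) \<bullet> (c' - ?x (Suc m)) \<le> 0"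
    using closest_point_dot[OF convex_C closed_C c'(1)] by simp
  moreover have "(?x m - ?x (Suc m)) \<bullet> ((c - c') + (?x (Suc m) - ?x j)) \<le> (\<kappa> * h) * (2 * \<kappa> * (\<delta> + h))"
    using catch_up_step[of m] far \<kappa> h
    by (intro order_trans[OF norm_cauchy_schwarz] mult_mono) (auto simp: norm_minus_commute)
  moreover have "(?x m - ?x (Suc m)) \<bullet> (c - ?x j)
      = (?x m - ?x (Suc m)) \<bullet> (c' - ?x (Suc m)) + (?x m - ?x (Suc m)) \<bullet> ((c - c') + (?x (Suc m) - ?x j))"
    by (simp add: algebra_simps del: catch_up.simps)
  moreover have "(?x j - ?x (Suc m)) \<bullet> (c - ?x j) = (?x j - ?x m) \<bullet> (c - ?x j) + (?x m - ?x (Suc m)) \<bullet> (c - ?x j)"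
    by (simp add: algebra_simps del: catch_up.simps)
  moreover have "(real (Suc m) * h - real j * h) * (2 * \<kappa>\<^sup>2 * (\<delta> + h))
      = (real m * h - real j * h) * (2 * \<kappa>\<^sup>2 * (\<delta> + h)) + (\<kappa> * h) * (2 * \<kappa> * (\<delta> + h))"
    by (simp add: algebra_simps power2_eq_square)
  ultimately show ?case
    using step.IH le(1) by linarith
qed simp

end

text \<open>
  These sets are closed in the topology of pointwise convergence and shrink with \<open>h\<close>, so by Tychonoff
  they have a common element, which satisfies the defining inequalities with \<open>h = 0\<close>.
\<close>

definition approximants :: "real \<Rightarrow> (real \<Rightarrow> 'a) set" where
  "approximants h = {f. f 0 = x0 \<and> (\<forall>t. f t \<in> cball 0 R) \<and>
     (\<forall>s t. 0 \<le> s \<and> s \<le> t \<longrightarrow> norm (f s - f t) \<le> \<kappa> * (t - s + h)) \<and>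
     (\<forall>t. 0 \<le> t \<longrightarrow> infdist (f t) (C t) \<le> \<kappa> * h) \<and>
     (\<forall>t \<delta> c. 0 \<le> t \<and> 0 \<le> \<delta> \<and> \<delta> \<le> \<eta> \<and> c \<in> C t \<longrightarrow>
        (f t - f (t + \<delta>)) \<bullet> (c - f t) \<le> 2 * \<kappa>\<^sup>2 * (\<delta> + h)\<^sup>2)}"

lemma approximants_mono: "0 \<le> h \<Longrightarrow> h \<le> h' \<Longrightarrow> approximants h \<subseteq> approximants h'"
  unfolding approximants_def
proof (safe, goal_cases)
  case (1 f s t)
  then have "\<kappa> * (t - s + h) \<le> \<kappa> * (t - s + h')"
    using \<kappa> by (intro mult_left_mono) auto
  then show ?case
    using 1 by (meson order_trans)
next
  case (2 f t)
  then have "\<kappa> * h \<le> \<kappa> * h'"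
    using \<kappa> by (intro mult_left_mono) auto
  then show ?case
    using 2 by (meson order_trans)
next
  case (3 f t \<delta> c)
  then have "2 * \<kappa>\<^sup>2 * (\<delta> + h)\<^sup>2 \<le> 2 * \<kappa>\<^sup>2 * (\<delta> + h')\<^sup>2"
    by (intro mult_left_mono power_mono) auto
  then show ?case
    using 3 by (meson order_trans)
qed

lemma approximants_closed: "closed (approximants h)"
proof -
  have coord: "continuous_on UNIV (\<lambda>f :: real \<Rightarrow> 'a. f t)" for t
    by (rule continuous_on_product_coordinates)
  have "closed {f :: real \<Rightarrow> 'a. f 0 = x0}"
    by (intro closed_Collect_eq coord continuous_on_const)
  moreover have "closed {f :: real \<Rightarrow> 'a. \<forall>t. f t \<in> cball 0 R}"
    unfolding mem_cball_0 by (intro closed_Collect_all closed_Collect_le continuous_on_norm coord continuous_on_const)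
  moreover have "closed {f :: real \<Rightarrow> 'a. \<forall>s t. 0 \<le> s \<and> s \<le> t \<longrightarrow> norm (f s - f t) \<le> \<kappa> * (t - s + h)}"
    by (intro closed_Collect_all closed_Collect_imp open_Collect_const closed_Collect_le
        continuous_on_norm continuous_on_diff coord continuous_on_const)
  moreover have "closed {f :: real \<Rightarrow> 'a. \<forall>t. 0 \<le> t \<longrightarrow> infdist (f t) (C t) \<le> \<kappa> * h}"
    by (intro closed_Collect_all closed_Collect_imp open_Collect_const closed_Collect_le
        continuous_on_infdist coord continuous_on_const)
  moreover have "closed {f :: real \<Rightarrow> 'a. \<forall>t \<delta> c. 0 \<le> t \<and> 0 \<le> \<delta> \<and> \<delta> \<le> \<eta> \<and> c \<in> C t \<longrightarrow>
        (f t - f (t + \<delta>)) \<bullet> (c - f t) \<le> 2 * \<kappa>\<^sup>2 * (\<delta> + h)\<^sup>2}"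
    by (intro closed_Collect_all closed_Collect_imp open_Collect_const closed_Collect_le
        continuous_on_inner continuous_on_diff coord continuous_on_const)
  ultimately show ?thesis
    unfolding approximants_def by (intro closed_Collect_conj)
qed

text \<open>The witness keeps the latest catching-up value until the next mesh time. Rounding a time
  down to the mesh loses less than \<open>h\<close>, which is the origin of the terms in
  \<open>h\<close> in the estimates of \<open>approximants\<close>.\<close>

lemma approximants_nonempty:
  assumes h: "0 < h" "h \<le> \<eta>"
  shows "approximants h \<noteq> {}"
proof -
  define J where "J t = nat \<lfloor>t / h\<rfloor>" for t
  define f where "f t = catch_up h (J t)" for t
  have J: "real (J t) * h \<le> t" "t < real (J t) * h + h" if "0 \<le> t" for t
  proof -
    have "real (J t) = of_int \<lfloor>t / h\<rfloor>"
      using that h by (simp add: J_def)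
    moreover have "of_int \<lfloor>t / h\<rfloor> \<le> t / h" "t / h < of_int \<lfloor>t / h\<rfloor> + 1"
      by linarith+
    ultimately have "real (J t) \<le> t / h" "t / h < real (J t) + 1"
      by simp_all
    then show "real (J t) * h \<le> t" "t < real (J t) * h + h"
      using h by (simp_all add: field_simps)
  qed
  have J_mono: "J s \<le> J t" if "s \<le> t" for s t
    unfolding J_def using that h by (intro nat_mono floor_mono divide_right_mono) auto
  have "f \<in> approximants h"
    unfolding approximants_def
  proof (intro CollectI conjI allI impI; (elim conjE)?)
    show "f 0 = x0"
      by (simp add: f_def J_def)
    show "f t \<in> cball 0 R" for t
      unfolding f_def using catch_up_mem[OF h] bdd_C by blast
    show "norm (f s - f t) \<le> \<kappa> * (t - s + h)" if "0 \<le> s" "s \<le> t" for s t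
    proof -
      have "norm (f s - f t) \<le> \<kappa> * (real (J t) * h - real (J s) * h)"
        using catch_up_dist[OF h J_mono[OF that(2)]] by (simp add: f_def norm_minus_commute)
      also have "\<dots> \<le> \<kappa> * (t - s + h)"
        using J[of s] J[of t] that \<kappa> by (intro mult_left_mono) auto
      finally show ?thesis .
    qed
    show "infdist (f t) (C t) \<le> \<kappa> * h" if "0 \<le> t" for t
    proof -
      have "\<bar>real (J t) * h - t\<bar> \<le> h"
        using J[OF that] by auto
      moreover obtain y where y: "y \<in> C t" "norm (f t - y) \<le> \<kappa> * \<bar>real (J t) * h - t\<bar>"
        using lip_C[OF _ catch_up_mem[OF h, of "J t"], of t] calculation h by (auto simp: f_def)
      ultimately have "norm (f t - y) \<le> \<kappa> * h"
        using mult_left_mono[OF _ \<kappa>] by (meson order_trans)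
      then show ?thesis
        using infdist_le[OF y(1), of "f t"] by (simp add: dist_norm)
    qed
    show "(f t - f (t + \<delta>)) \<bullet> (c - f t) \<le> 2 * \<kappa>\<^sup>2 * (\<delta> + h)\<^sup>2"
      if "0 \<le> t" "0 \<le> \<delta>" "\<delta> \<le> \<eta>" "c \<in> C t" for t \<delta> c
    proof -
      have "(f t - f (t + \<delta>)) \<bullet> (c - f t) \<le> (real (J (t + \<delta>)) * h - real (J t) * h) * (2 * \<kappa>\<^sup>2 * (\<delta> + h))"
        unfolding f_def using that J[of t] J[of "t + \<delta>"] J_mono[of t "t + \<delta>"]
        by (intro catch_up_variational[OF h]) auto
      also have "\<dots> \<le> (\<delta> + h) * (2 * \<kappa>\<^sup>2 * (\<delta> + h))"
        using J[of t] J[of "t + \<delta>"] that h by (intro mult_right_mono) auto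
      finally show ?thesis
        by (simp add: power2_eq_square algebra_simps)
    qed
  qed
  then show ?thesis
    by blast
qed

lemma variational_solution_exists:
  obtains f where "f 0 = x0" "\<kappa>-lipschitz_on {0..} f" "\<And>t. 0 \<le> t \<Longrightarrow> f t \<in> C t"
    "\<And>t \<delta> c. 0 \<le> t \<Longrightarrow> 0 \<le> \<delta> \<Longrightarrow> \<delta> \<le> \<eta> \<Longrightarrow> c \<in> C t \<Longrightarrow> (f t - f (t + \<delta>)) \<bullet> (c - f t) \<le> 2 * \<kappa>\<^sup>2 * \<delta>\<^sup>2"
proof -
  \<comment> \<open>The empty value for \<open>h \<le> 0\<close> makes the family monotone over all
    reals; the square \<open>(\<delta> + h)\<^sup>2\<close> would spoil this for negative
    \<open>h\<close>.\<close>
  define A where "A h = (if h \<le> 0 then {} else approximants h)" for h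
  have "\<exists>f. \<forall>h. 0 < h \<and> h \<le> \<eta> \<longrightarrow> f \<in> A h"
  proof (rule decreasing_closed_pointwise_inter[OF \<eta>])
    show "A h \<subseteq> A h'" if "h \<le> h'" for h h'
      using approximants_mono[of h h'] that by (auto simp: A_def)
    show "f t \<in> cball 0 R" if "f \<in> A h" for h f t
      using that by (auto simp: A_def approximants_def split: if_splits)
  qed (auto simp: A_def approximants_closed approximants_nonempty)
  then obtain f where f: "\<And>h. 0 < h \<Longrightarrow> h \<le> \<eta> \<Longrightarrow> f \<in> approximants h"
    by (auto simp: A_def)
  have dist_f: "norm (f s - f t) \<le> \<kappa> * (t - s)" if "0 \<le> s" "s \<le> t" for s t
  proof -
    have "norm (f s - f t) \<le> \<kappa> * (t - s + h)" if "0 < h" "h \<le> \<eta>" for h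
      using f[OF that] \<open>0 \<le> s\<close> \<open>s \<le> t\<close> unfolding approximants_def by blast
    then show ?thesis
      using le_at_zero_rightI[OF \<eta>, of _ "\<lambda>h. \<kappa> * (t - s + h)"] by simp
  qed
  have "f t \<in> C t" if "0 \<le> t" for t
  proof -
    have "infdist (f t) (C t) \<le> \<kappa> * h" if "0 < h" "h \<le> \<eta>" for h
      using f[OF that] \<open>0 \<le> t\<close> unfolding approximants_def by blast
    then have "infdist (f t) (C t) \<le> 0"
      using le_at_zero_rightI[OF \<eta>, of _ "\<lambda>h. \<kappa> * h"] by simp
    then have "infdist (f t) (C t) = 0"
      using infdist_nonneg[of "f t" "C t"] by linarith
    then show ?thesis
      using in_closed_iff_infdist_zero[OF closed_C ne_C] by blast
  qed
  moreover have "(f t - f (t + \<delta>)) \<bullet> (c - f t) \<le> 2 * \<kappa>\<^sup>2 * \<delta>\<^sup>2"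
    if *: "0 \<le> t" "0 \<le> \<delta>" "\<delta> \<le> \<eta>" "c \<in> C t" for t \<delta> c
  proof -
    have "(f t - f (t + \<delta>)) \<bullet> (c - f t) \<le> 2 * \<kappa>\<^sup>2 * (\<delta> + h)\<^sup>2" if "0 < h" "h \<le> \<eta>" for h
      using f[OF that] * unfolding approximants_def by blast
    then show ?thesis
      using le_at_zero_rightI[OF \<eta>, of _ "\<lambda>h. 2 * \<kappa>\<^sup>2 * (\<delta> + h)\<^sup>2"] by simp
  qed
  moreover have "\<kappa>-lipschitz_on {0..} f"
  proof (rule lipschitz_onI[OF _ \<kappa>])
    fix s t :: real assume "s \<in> {0..}" "t \<in> {0..}"
    then show "dist (f s) (f t) \<le> \<kappa> * dist s t"
      using dist_f[of s t] dist_f[of t s] by (cases "s \<le> t") (auto simp: dist_norm norm_minus_commute)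
  qed
  moreover have "f 0 = x0"
    using f[of \<eta>] \<eta> by (simp add: approximants_def)
  ultimately show thesis
    using that by blast
qed

text \<open>The variational error is quadratic in \<open>\<delta>\<close>, so after division by
  \<open>\<delta>\<close> it vanishes in the limit and leaves the normal cone inequality for the
  velocity.\<close>

lemma sweeping_solution_exists: "\<exists>f. sweeping_solution C f \<and> f 0 = x0"
proof -
  obtain f where f: "f 0 = x0" "\<kappa>-lipschitz_on {0..} f" "\<And>t. 0 \<le> t \<Longrightarrow> f t \<in> C t"
    "\<And>t \<delta> c. 0 \<le> t \<Longrightarrow> 0 \<le> \<delta> \<Longrightarrow> \<delta> \<le> \<eta> \<Longrightarrow> c \<in> C t \<Longrightarrow> (f t - f (t + \<delta>)) \<bullet> (c - f t) \<le> 2 * \<kappa>\<^sup>2 * \<delta>\<^sup>2"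
    by (rule variational_solution_exists) blast
  \<comment> \<open>Freezing \<open>f\<close> to the left of \<open>0\<close> gives a function that
    is Lipschitz on the whole line and agrees with \<open>f\<close> near every positive time. Time
    \<open>0\<close> itself is added to the exceptional set.\<close>
  have "\<kappa>-lipschitz_on UNIV (\<lambda>t. f (max 0 t))"
  proof (rule lipschitz_onI[OF _ \<kappa>])
    fix s t :: real
    have "dist (f (max 0 s)) (f (max 0 t)) \<le> \<kappa> * dist (max 0 s) (max 0 t)"
      using lipschitz_onD[OF f(2)] by simp
    also have "\<dots> \<le> \<kappa> * dist s t"
      using \<kappa> by (intro mult_left_mono) (auto simp: dist_real_def)
    finally show "dist (f (max 0 s)) (f (max 0 t)) \<le> \<kappa> * dist s t" .
  qed
  then obtain N where N: "negligible N" "\<And>t. t \<notin> N \<Longrightarrow> \<exists>D. ((\<lambda>t. f (max 0 t)) has_vector_derivative D) (at t)"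
    using lipschitz_vector_derivative_ae by blast
  have "\<exists>v. (f has_vector_derivative v) (at t) \<and> - v \<in> normal_cone (C t) (f t)" if "t \<notin> insert 0 N" "0 \<le> t" for t
  proof -
    have "t > 0" "t \<notin> N"
      using that by auto
    then obtain v where "((\<lambda>t. f (max 0 t)) has_vector_derivative v) (at t)"
      using N(2) by blast
    then have v: "(f has_vector_derivative v) (at t)"
      by (rule has_vector_derivative_transform_within_open[of _ _ _ "{0<..}"]) (use \<open>t > 0\<close> in auto)
    have "(- v) \<bullet> (c - f t) \<le> 0" if "c \<in> C t" for c
    proof -
      let ?w = "c - f t"
      have "((\<lambda>h. (f (t + h) \<bullet> ?w - f t \<bullet> ?w) / h) \<longlongrightarrow> v \<bullet> ?w) (at_right 0)"
        using has_vector_derivative_inner_real[OF v, of ?w] by (simp add: DERIV_def filterlim_at_split)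
      moreover have "((\<lambda>h. - (2 * \<kappa>\<^sup>2 * h)) \<longlongrightarrow> - (2 * \<kappa>\<^sup>2 * 0)) (at_right 0)"
        by (intro tendsto_intros)
      moreover have "\<forall>\<^sub>F h in at_right 0. - (2 * \<kappa>\<^sup>2 * h) \<le> (f (t + h) \<bullet> ?w - f t \<bullet> ?w) / h"
        unfolding eventually_at_right_field
      proof (intro exI[of _ \<eta>] conjI allI impI)
        fix h assume "0 < h" "h < \<eta>"
        then show "- (2 * \<kappa>\<^sup>2 * h) \<le> (f (t + h) \<bullet> ?w - f t \<bullet> ?w) / h"
          using f(4)[of t h c] \<open>t > 0\<close> that by (simp add: field_simps power2_eq_square inner_diff_left)
      qed (rule \<eta>)
      ultimately have "- (2 * \<kappa>\<^sup>2 * 0) \<le> v \<bullet> ?w"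
        by (intro tendsto_le) auto
      then show ?thesis
        by simp
    qed
    then show ?thesis
      using v f(3)[OF \<open>0 \<le> t\<close>] by (auto simp: normal_cone_def)
  qed
  moreover have "negligible (insert 0 N)"
    using N(1) by simp
  ultimately have "AE t in lborel. t \<ge> 0 \<longrightarrow> (\<exists>v. (f has_vector_derivative v) (at t) \<and> - v \<in> normal_cone (C t) (f t))"
    unfolding AE_lborel_iff_negligible by blast
  then have "sweeping_solution C f"
    using f unfolding sweeping_solution_def by blast
  then show ?thesis
    using f(1) by blast
qed

end

section \<open>Long-time behaviour of solutions\<close>

lemma sweeping_solutionE:
  assumes "sweeping_solution Cs x"
  obtains L N where "L-lipschitz_on {0..} x" "\<And>t. 0 \<le> t \<Longrightarrow> x t \<in> Cs t" "negligible N"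
    "\<And>t. 0 \<le> t \<Longrightarrow> t \<notin> N \<Longrightarrow> \<exists>v. (x has_vector_derivative v) (at t) \<and> - v \<in> normal_cone (Cs t) (x t)"
  using assms unfolding sweeping_solution_def AE_lborel_iff_negligible by blast

lemma sweeping_solution_shift:
  assumes x: "sweeping_solution Cs x" and "0 \<le> a" and per: "\<And>t. Cs (t + a) = Cs t"
  shows "sweeping_solution Cs (\<lambda>t. x (t + a))"
proof -
  obtain L N where L: "L-lipschitz_on {0..} x" and mem: "\<And>t. 0 \<le> t \<Longrightarrow> x t \<in> Cs t" and N: "negligible N"
    and deriv: "\<And>t. 0 \<le> t \<Longrightarrow> t \<notin> N \<Longrightarrow> \<exists>v. (x has_vector_derivative v) (at t) \<and> - v \<in> normal_cone (Cs t) (x t)"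
    by (rule sweeping_solutionE[OF x]) blast
  have "L-lipschitz_on {0..} (\<lambda>t. x (t + a))"
  proof (rule lipschitz_onI)
    fix s t :: real assume "s \<in> {0..}" "t \<in> {0..}"
    then show "dist (x (s + a)) (x (t + a)) \<le> L * dist s t"
      using lipschitz_onD[OF L, of "s + a" "t + a"] \<open>0 \<le> a\<close> by (simp add: dist_real_def)
  qed (rule lipschitz_on_nonneg[OF L])
  moreover have "x (t + a) \<in> Cs t" if "0 \<le> t" for t
    using mem[of "t + a"] that \<open>0 \<le> a\<close> per by simp
  moreover have "\<exists>v. ((\<lambda>t. x (t + a)) has_vector_derivative v) (at t) \<and> - v \<in> normal_cone (Cs t) (x (t + a))"
    if t: "0 \<le> t" "t \<notin> (+) (- a) ` N" for t
  proof -
    have "t + a \<notin> N"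
      using t(2) by (auto simp: image_iff)
    then obtain v where v: "(x has_vector_derivative v) (at (t + a))" "- v \<in> normal_cone (Cs t) (x (t + a))"
      using deriv[of "t + a"] t(1) \<open>0 \<le> a\<close> per by auto
    have "(x \<circ> (\<lambda>t. t + a) has_vector_derivative 1 *\<^sub>R v) (at t)"
      by (rule vector_diff_chain_at) (auto intro!: derivative_eq_intros v(1))
    then show ?thesis
      using v(2) by (auto simp: o_def)
  qed
  moreover have "negligible ((+) (- a) ` N)"
    using N by (rule negligible_translation)
  ultimately show ?thesis
    unfolding sweeping_solution_def AE_lborel_iff_negligible by blast
qed

text \<open>Monotonicity of the normal cone: each velocity is tested with the position of the other
  solution, and the sum of the two inequalities bounds the derivative of the squared distance by
  \<open>0\<close>.\<close>

lemma sweeping_solutions_norm_nonincreasing: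
  assumes x: "sweeping_solution Cs x" and y: "sweeping_solution Cs y" and "0 \<le> s" "s \<le> t"
  shows "norm (x t - y t) \<le> norm (x s - y s)"
proof -
  obtain L N where L: "L-lipschitz_on {0..} x" and mem: "\<And>t. 0 \<le> t \<Longrightarrow> x t \<in> Cs t" and N: "negligible N"
    and deriv: "\<And>t. 0 \<le> t \<Longrightarrow> t \<notin> N \<Longrightarrow> \<exists>v. (x has_vector_derivative v) (at t) \<and> - v \<in> normal_cone (Cs t) (x t)"
    by (rule sweeping_solutionE[OF x]) blast
  obtain L' N' where L': "L'-lipschitz_on {0..} y" and mem': "\<And>t. 0 \<le> t \<Longrightarrow> y t \<in> Cs t" and N': "negligible N'"
    and deriv': "\<And>t. 0 \<le> t \<Longrightarrow> t \<notin> N' \<Longrightarrow> \<exists>v. (y has_vector_derivative v) (at t) \<and> - v \<in> normal_cone (Cs t) (y t)"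
    by (rule sweeping_solutionE[OF y]) blast
  define w where "w t = x t - y t" for t
  have Lw: "(L + L')-lipschitz_on {s..t} w"
    unfolding w_def using \<open>0 \<le> s\<close> by (intro lipschitz_on_diff lipschitz_on_subset[OF L] lipschitz_on_subset[OF L']) auto
  \<comment> \<open>The squared norm is differentiable wherever \<open>w\<close> is, even where
    \<open>w\<close> vanishes, but it is Lipschitz only on bounded sets; \<open>B\<close> provides
    the bound.\<close>
  define B where "B = norm (w s) + (L + L') * (t - s)"
  have B: "norm (w r) \<le> B" if "r \<in> {s..t}" for r
  proof -
    have "norm (w r) \<le> norm (w s) + norm (w r - w s)"
      by (metis add.commute norm_triangle_sub)
    also have "norm (w r - w s) \<le> (L + L') * (r - s)"
      using lipschitz_onD[OF Lw that, of s] that by (auto simp: dist_norm)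
    also have "\<dots> \<le> (L + L') * (t - s)"
      using that lipschitz_on_nonneg[OF Lw] by (intro mult_left_mono) auto
    finally show ?thesis
      by (simp add: B_def)
  qed
  have "B \<ge> 0"
    using B[of s] \<open>s \<le> t\<close> norm_ge_zero[of "w s"] by (smt (verit) atLeastAtMost_iff)
  have "((L + L') * (2 * B))-lipschitz_on {s..t} (\<lambda>r. w r \<bullet> w r)"
  proof (rule lipschitz_onI)
    fix p q assume pq: "p \<in> {s..t}" "q \<in> {s..t}"
    have "\<bar>w p \<bullet> w p - w q \<bullet> w q\<bar> = \<bar>(w p - w q) \<bullet> (w p + w q)\<bar>"
      by (simp add: algebra_simps inner_commute)
    also have "\<dots> \<le> norm (w p - w q) * norm (w p + w q)"
      by (rule Cauchy_Schwarz_ineq2)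
    also have "\<dots> \<le> ((L + L') * dist p q) * (2 * B)"
    proof (rule mult_mono)
      show "norm (w p - w q) \<le> (L + L') * dist p q"
        using lipschitz_onD[OF Lw pq] by (simp add: dist_norm)
      show "norm (w p + w q) \<le> 2 * B"
        using norm_triangle_mono[OF B[OF pq(1)] B[OF pq(2)]] by simp
      show "0 \<le> (L + L') * dist p q"
        using lipschitz_on_nonneg[OF Lw] by simp
    qed simp
    finally show "dist (w p \<bullet> w p) (w q \<bullet> w q) \<le> (L + L') * (2 * B) * dist p q"
      by (simp add: dist_real_def algebra_simps)
  qed (use lipschitz_on_nonneg[OF Lw] \<open>B \<ge> 0\<close> in simp)
  moreover have "\<exists>D\<le>0. ((\<lambda>r. w r \<bullet> w r) has_real_derivative D) (at r)" if "r \<in> {s<..<t} - (N \<union> N')" for r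
  proof -
    have r: "0 \<le> r" "r \<notin> N" "r \<notin> N'"
      using that \<open>0 \<le> s\<close> by auto
    obtain v where v: "(x has_vector_derivative v) (at r)" "- v \<in> normal_cone (Cs r) (x r)"
      using deriv r by blast
    obtain v' where v': "(y has_vector_derivative v') (at r)" "- v' \<in> normal_cone (Cs r) (y r)"
      using deriv' r by blast
    have "(w has_vector_derivative (v - v')) (at r)"
      unfolding w_def by (intro derivative_intros v v')
    then have "((\<lambda>r. w r \<bullet> w r) has_vector_derivative (w r \<bullet> (v - v') + (v - v') \<bullet> w r)) (at r)"
      by (intro bounded_bilinear.has_vector_derivative[OF bounded_bilinear_inner])
    moreover have "(- v) \<bullet> (y r - x r) \<le> 0" "(- v') \<bullet> (x r - y r) \<le> 0"
      using v(2) v'(2) mem mem' r(1) by (auto simp: normal_cone_def split: if_splits)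
    then have "w r \<bullet> (v - v') + (v - v') \<bullet> w r \<le> 0"
      by (simp add: w_def inner_commute algebra_simps)
    ultimately show ?thesis
      unfolding has_real_derivative_iff_has_vector_derivative by blast
  qed
  ultimately have "w t \<bullet> w t \<le> w s \<bullet> w s"
    using negligible_Un[OF N N'] by (intro lipschitz_nonincreasingI[OF \<open>s \<le> t\<close>])
  then show ?thesis
    by (simp add: w_def norm_le)
qed

section \<open>Rigidity of solutions at constant distance\<close>

text \<open>Testing with the increment \<open>b\<close> itself reduces the claim to a scalar:
  \<open>w s \<bullet> b\<close> does not increase, hence
  \<open>b \<bullet> b \<le> 0\<close>.\<close>

lemma lipschitz_zero_derivative_constant:
  fixes w :: "real \<Rightarrow> 'a::euclidean_space"
  assumes lip: "L-lipschitz_on {0..} w" and N: "negligible N"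
    and deriv: "\<And>t. 0 < t \<Longrightarrow> t \<notin> N \<Longrightarrow> (w has_vector_derivative 0) (at t)" and "0 \<le> t"
  shows "w t = w 0"
proof -
  define b where "b = w t - w 0"
  have "w t \<bullet> b \<le> w 0 \<bullet> b"
  proof (rule lipschitz_nonincreasingI[OF \<open>0 \<le> t\<close> _ N])
    show "(L * norm b)-lipschitz_on {0..t} (\<lambda>s. w s \<bullet> b)"
    proof (rule lipschitz_onI)
      fix p q assume "p \<in> {0..t}" "q \<in> {0..t}"
      then have "norm (w p - w q) \<le> L * dist p q"
        using lipschitz_onD[OF lip, of p q] by (simp add: dist_norm)
      then have "norm (w p - w q) * norm b \<le> L * dist p q * norm b"
        by (rule mult_right_mono) simp
      moreover have "\<bar>(w p - w q) \<bullet> b\<bar> \<le> norm (w p - w q) * norm b"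
        by (rule Cauchy_Schwarz_ineq2)
      ultimately show "dist (w p \<bullet> b) (w q \<bullet> b) \<le> L * norm b * dist p q"
        by (simp add: dist_real_def inner_diff_left mult_ac)
    qed (use lipschitz_on_nonneg[OF lip] in simp)
    fix s assume "s \<in> {0<..<t} - N"
    then have "((\<lambda>s. w s \<bullet> b) has_real_derivative 0 \<bullet> b) (at s)"
      by (intro has_vector_derivative_inner_real deriv) auto
    then show "\<exists>D\<le>0. ((\<lambda>s. w s \<bullet> b) has_real_derivative D) (at s)"
      by auto
  qed
  then have "b \<bullet> b \<le> 0"
    by (simp add: b_def inner_diff_left)
  then show ?thesis
    using inner_ge_zero[of b] inner_eq_zero_iff[of b] by (simp add: b_def del: inner_ge_zero inner_eq_zero_iff)
qed

lemma has_vector_derivative_remainder: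
  assumes "(f has_vector_derivative v) (at t)" "e > 0"
  shows "\<exists>d>0. \<forall>h. \<bar>h\<bar> < d \<longrightarrow> norm (f (t + h) - f t - h *\<^sub>R v) \<le> e * \<bar>h\<bar>"
proof -
  obtain d where "d > 0" "\<And>s. norm (s - t) < d \<Longrightarrow> norm (f s - f t - (s - t) *\<^sub>R v) \<le> e * norm (s - t)"
    using assms unfolding has_vector_derivative_def has_derivative_at_alt by blast
  then show ?thesis
    by (intro exI[of _ d]) (auto dest!: spec[of _ "t + _"], metis add_diff_cancel_left' real_norm_def)
qed

text \<open>
  The midpoint of \<open>y (t + h) - c i (t + h)\<close> and \<open>x (t - h) - c i (t - h)\<close> lies in \<open>C i\<close>, and up to \<open>o(h)\<close> the
  motion of \<open>c i\<close> cancels in it. Hence the single point \<open>(x t + y t) / 2 + (h / 2) (vy - vx)\<close> is \<open>o(h)\<close>-close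
  to every \<open>C i + c i t\<close>, and by regularity to their intersection.
\<close>

lemma midpoint_velocity_le:
  fixes C :: "'i \<Rightarrow> 'a::euclidean_space set"
  assumes "finite I" and convex: "\<And>i. i \<in> I \<Longrightarrow> convex (C i)" and "\<kappa> \<ge> 0"
    and reg: "\<And>a z \<epsilon>. \<epsilon> \<ge> 0 \<Longrightarrow> \<forall>i\<in>I. z - a i \<in> C i \<Longrightarrow> \<forall>i\<in>I. norm (a i - c i t) \<le> \<epsilon> \<Longrightarrow>
       norm z \<le> norm ((1/2) *\<^sub>R (x t + y t)) + 1 \<Longrightarrow> \<exists>q. (\<forall>i\<in>I. q - c i t \<in> C i) \<and> norm (z - q) \<le> \<kappa> * \<epsilon>"
    and "t > 0"
    and x: "\<And>s i. 0 \<le> s \<Longrightarrow> i \<in> I \<Longrightarrow> x s - c i s \<in> C i" and y: "\<And>s i. 0 \<le> s \<Longrightarrow> i \<in> I \<Longrightarrow> y s - c i s \<in> C i"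
    and dx: "(x has_vector_derivative vx) (at t)" and dy: "(y has_vector_derivative vy) (at t)"
    and dc: "\<And>i. i \<in> I \<Longrightarrow> (c i has_vector_derivative vc i) (at t)"
    and \<zeta>: "\<And>q. \<forall>i\<in>I. q - c i t \<in> C i \<Longrightarrow> \<zeta> \<bullet> (q - x t) \<le> 0" and orth: "\<zeta> \<bullet> (y t - x t) = 0"
  shows "\<zeta> \<bullet> (vy - vx) \<le> 0"
proof -
  have "\<zeta> \<bullet> (vy - vx) \<le> 0 + 4 * (norm \<zeta> * \<kappa>) * e" if "e > 0" for e
  proof -
    obtain d1 where d1: "d1 > 0" "\<And>h. \<bar>h\<bar> < d1 \<Longrightarrow> norm (x (t + h) - x t - h *\<^sub>R vx) \<le> e * \<bar>h\<bar>"
      using has_vector_derivative_remainder[OF dx \<open>e > 0\<close>] by blast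
    obtain d2 where d2: "d2 > 0" "\<And>h. \<bar>h\<bar> < d2 \<Longrightarrow> norm (y (t + h) - y t - h *\<^sub>R vy) \<le> e * \<bar>h\<bar>"
      using has_vector_derivative_remainder[OF dy \<open>e > 0\<close>] by blast
    have "\<forall>i\<in>I. \<exists>d>0. \<forall>h. \<bar>h\<bar> < d \<longrightarrow> norm (c i (t + h) - c i t - h *\<^sub>R vc i) \<le> e * \<bar>h\<bar>"
      using has_vector_derivative_remainder[OF dc \<open>e > 0\<close>] by blast
    then obtain d3 where d3: "\<And>i. i \<in> I \<Longrightarrow> d3 i > 0"
      "\<And>i h. i \<in> I \<Longrightarrow> \<bar>h\<bar> < d3 i \<Longrightarrow> norm (c i (t + h) - c i t - h *\<^sub>R vc i) \<le> e * \<bar>h\<bar>"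
      by metis
    \<comment> \<open>The entry \<open>t\<close> keeps \<open>t - h\<close> nonnegative,
      \<open>d1\<close>, \<open>d2\<close> and \<open>d3\<close> control the remainders, and the
      quotient keeps \<open>m\<close> within distance \<open>1\<close> of the midpoint, as
      \<open>reg\<close> demands.\<close>
    define d where "d = Min (insert t (insert d1 (insert d2 (insert (1 / (norm (vy - vx) + 1)) (d3 ` I)))))"
    have "d > 0"
      unfolding d_def using \<open>finite I\<close> \<open>t > 0\<close> d1(1) d2(1) d3(1)
      by (subst Min_gr_iff) (auto intro!: divide_pos_pos add_nonneg_pos)
    have d: "d \<le> t" "d \<le> d1" "d \<le> d2" "d \<le> 1 / (norm (vy - vx) + 1)" "\<And>i. i \<in> I \<Longrightarrow> d \<le> d3 i"
      unfolding d_def using \<open>finite I\<close> by (auto intro!: Min_le simp del: Min_insert)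
    define h where "h = d / 2"
    have h: "0 < h" "h < d"
      using \<open>d > 0\<close> by (auto simp: h_def)
    define m where "m = (1/2) *\<^sub>R (x t + y t) + (h / 2) *\<^sub>R (vy - vx)"
    \<comment> \<open>\<open>a i\<close> is defined backwards: it is the translation for which
      \<open>m - a i\<close> is exactly the midpoint of two points of \<open>C i\<close>. Only its
      distance to \<open>c i t\<close> remains to be estimated.\<close>
    define a where "a i = m - ((1/2) *\<^sub>R (y (t + h) - c i (t + h)) + (1/2) *\<^sub>R (x (t - h) - c i (t - h)))" for i
    have "m - a i \<in> C i" if "i \<in> I" for i
    proof -
      have "(1/2) *\<^sub>R (y (t + h) - c i (t + h)) + (1/2) *\<^sub>R (x (t - h) - c i (t - h)) \<in> C i"
        using x[of "t - h" i] y[of "t + h" i] h d that convex[OF that] by (intro convexD) auto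
      then show ?thesis
        by (simp add: a_def add.commute)
    qed
    moreover have "norm (a i - c i t) \<le> 2 * e * h" if "i \<in> I" for i
    proof -
      let ?ry = "y (t + h) - y t - h *\<^sub>R vy" and ?rx = "x (t + - h) - x t - (- h) *\<^sub>R vx"
      let ?rc = "c i (t + h) - c i t - h *\<^sub>R vc i" and ?rc' = "c i (t + - h) - c i t - (- h) *\<^sub>R vc i"
      have "2 *\<^sub>R (a i - c i t) = (?rc + ?rc') - (?ry + ?rx)"
        unfolding a_def m_def by (simp add: algebra_simps scaleR_2)
      then have "2 * norm (a i - c i t) = norm ((?rc + ?rc') - (?ry + ?rx))"
        by (metis norm_scaleR abs_numeral)
      also have "norm ((?rc + ?rc') - (?ry + ?rx)) \<le> norm (?rc + ?rc') + norm (?ry + ?rx)"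
        by (rule norm_triangle_ineq4)
      also have "\<dots> \<le> (e * h + e * h) + (e * h + e * h)"
        using d1(2)[of "- h"] d2(2)[of h] d3(2)[OF that, of h] d3(2)[OF that, of "- h"] h d(2,3) d(5)[OF that]
        by (intro add_mono norm_triangle_mono) auto
      finally show ?thesis
        by simp
    qed
    moreover have "norm m \<le> norm ((1/2) *\<^sub>R (x t + y t)) + 1"
    proof -
      have "norm ((h / 2) *\<^sub>R (vy - vx)) = (h / 2) * norm (vy - vx)"
        using h by simp
      also have "\<dots> \<le> h * (norm (vy - vx) + 1)"
        using h by (intro mult_mono) auto
      also have "\<dots> \<le> 1"
      proof -
        have "h \<le> 1 / (norm (vy - vx) + 1)"
          using h d(4) by linarith
        then show ?thesis
          by (subst (asm) pos_le_divide_eq) (auto intro: add_nonneg_pos)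
      qed
      finally show ?thesis
        unfolding m_def by (intro norm_triangle_mono order_refl)
    qed
    ultimately obtain q where q: "\<forall>i\<in>I. q - c i t \<in> C i" "norm (m - q) \<le> \<kappa> * (2 * e * h)"
      using reg[of "2 * e * h" m a] h \<open>e > 0\<close> by auto
    \<comment> \<open>By \<open>orth\<close> the contribution of order zero vanishes, so the
      velocity term, of order \<open>h\<close>, stands alone against an error of order
      \<open>e * h\<close>.\<close>
    have "\<zeta> \<bullet> (m - x t) = (h / 2) * (\<zeta> \<bullet> (vy - vx))"
    proof -
      have "2 *\<^sub>R (m - x t) = (y t - x t) + h *\<^sub>R (vy - vx)"
        unfolding m_def by (simp add: algebra_simps scaleR_2)
      then have "\<zeta> \<bullet> (2 *\<^sub>R (m - x t)) = h * (\<zeta> \<bullet> (vy - vx))"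
        using orth by (simp add: inner_add_right)
      then show ?thesis
        by simp
    qed
    moreover have "\<zeta> \<bullet> (m - x t) = \<zeta> \<bullet> (q - x t) + \<zeta> \<bullet> (m - q)"
      by (simp add: inner_diff_right)
    moreover have "\<zeta> \<bullet> (m - q) \<le> norm \<zeta> * (\<kappa> * (2 * e * h))"
      using q(2) by (intro order_trans[OF norm_cauchy_schwarz] mult_left_mono) auto
    ultimately have "(h / 2) * (\<zeta> \<bullet> (vy - vx)) \<le> norm \<zeta> * (\<kappa> * (2 * e * h))"
      using \<zeta>[OF q(1)] by linarith
    also have "\<dots> = (h / 2) * (4 * (norm \<zeta> * \<kappa>) * e)"
      by simp
    finally show ?thesis
      using h by (simp only: mult_le_cancel_left_pos half_gt_zero add_0)
  qed
  then show ?thesis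
    using le_at_zero_rightI[of 1 "\<zeta> \<bullet> (vy - vx)" "\<lambda>e. 0 + 4 * (norm \<zeta> * \<kappa>) * e"] by simp
qed

lemma sweeping_solutions_isometric_imp_translate:
  fixes C :: "'i \<Rightarrow> 'a::euclidean_space set"
  assumes "finite I" and convex: "\<And>i. i \<in> I \<Longrightarrow> convex (C i)"
    and slater: "\<And>t. 0 \<le> t \<Longrightarrow> \<exists>z. \<forall>i\<in>I. polyhedron (C i) \<and> z - c i t \<in> C i \<or> z - c i t \<in> rel_interior (C i)"
    and lip: "\<And>i. i \<in> I \<Longrightarrow> \<exists>L. L-lipschitz_on UNIV (c i)"
    and D: "\<And>t z. z \<in> D t \<longleftrightarrow> (\<forall>i\<in>I. z - c i t \<in> C i)"
    and x: "sweeping_solution D x" and y: "sweeping_solution D y"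
    and iso: "\<And>t. 0 \<le> t \<Longrightarrow> norm (x t - y t) = l" and "0 \<le> t"
  shows "x t - y t = x 0 - y 0"
proof -
  obtain L N where L: "L-lipschitz_on {0..} x" and mem: "\<And>t. 0 \<le> t \<Longrightarrow> x t \<in> D t" and N: "negligible N"
    and deriv: "\<And>t. 0 \<le> t \<Longrightarrow> t \<notin> N \<Longrightarrow> \<exists>v. (x has_vector_derivative v) (at t) \<and> - v \<in> normal_cone (D t) (x t)"
    by (rule sweeping_solutionE[OF x]) blast
  obtain L' N' where L': "L'-lipschitz_on {0..} y" and mem': "\<And>t. 0 \<le> t \<Longrightarrow> y t \<in> D t" and N': "negligible N'"
    and deriv': "\<And>t. 0 \<le> t \<Longrightarrow> t \<notin> N' \<Longrightarrow> \<exists>v. (y has_vector_derivative v) (at t) \<and> - v \<in> normal_cone (D t) (y t)"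
    by (rule sweeping_solutionE[OF y]) blast
  have "\<forall>i\<in>I. \<exists>M. negligible M \<and> (\<forall>t. t \<notin> M \<longrightarrow> (\<exists>v. (c i has_vector_derivative v) (at t)))"
    using lip lipschitz_vector_derivative_ae by blast
  then obtain M where M: "\<And>i. i \<in> I \<Longrightarrow> negligible (M i)"
    "\<And>i t. i \<in> I \<Longrightarrow> t \<notin> M i \<Longrightarrow> \<exists>v. (c i has_vector_derivative v) (at t)"
    by metis
  \<comment> \<open>The times where some \<open>c i\<close> has no derivative are excluded too,
    since the cancellation at \<open>t + h\<close> and \<open>t - h\<close> needs it.\<close>
  define K where "K = N \<union> N' \<union> (\<Union>i\<in>I. M i)"
  have "negligible K"
    unfolding K_def using N N' M(1) \<open>finite I\<close> by (intro negligible_Un negligible_Union) auto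
  have deriv0: "((\<lambda>t. x t - y t) has_vector_derivative 0) (at t)" if t: "0 < t" "t \<notin> K" for t
  proof -
    obtain v where v: "(x has_vector_derivative v) (at t)" "- v \<in> normal_cone (D t) (x t)"
      using deriv[of t] t by (auto simp: K_def)
    obtain v' where v': "(y has_vector_derivative v') (at t)" "- v' \<in> normal_cone (D t) (y t)"
      using deriv'[of t] t by (auto simp: K_def)
    have "\<forall>i\<in>I. \<exists>v. (c i has_vector_derivative v) (at t)"
      using M(2) t(2) by (auto simp: K_def)
    then obtain vc where vc: "\<And>i. i \<in> I \<Longrightarrow> (c i has_vector_derivative vc i) (at t)"
      by metis
    have cone: "(- v) \<bullet> (q - x t) \<le> 0" "(- v') \<bullet> (q - y t) \<le> 0" if "q \<in> D t" for q
      using v(2) v'(2) that by (auto simp: normal_cone_def split: if_splits)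
    have "((\<lambda>t. x t - y t) has_vector_derivative (v - v')) (at t)"
      by (intro derivative_intros v v')
    then have "((\<lambda>t. (x t - y t) \<bullet> (x t - y t)) has_vector_derivative
        ((x t - y t) \<bullet> (v - v') + (v - v') \<bullet> (x t - y t))) (at t)"
      by (intro bounded_bilinear.has_vector_derivative[OF bounded_bilinear_inner])
    moreover have "((\<lambda>t. (x t - y t) \<bullet> (x t - y t)) has_vector_derivative 0) (at t)"
    proof (rule has_vector_derivative_transform_within_open[of "\<lambda>_. l\<^sup>2" _ _ "{0<..}"])
      show "l\<^sup>2 = (x s - y s) \<bullet> (x s - y s)" if "s \<in> {0<..}" for s
        using iso[of s] that by (simp add: dot_square_norm)
    qed (use \<open>0 < t\<close> in auto)
    \<comment> \<open>The derivative of the constant squared distance is a sum of two terms of the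
      same sign, so both must vanish; these are the orthogonality relations
      \<open>orth\<close>.\<close>
    ultimately have "(x t - y t) \<bullet> (v - v') + (v - v') \<bullet> (x t - y t) = 0"
      using vector_derivative_unique_at by blast
    then have "(- v) \<bullet> (y t - x t) + (- v') \<bullet> (x t - y t) = 0"
      by (simp add: inner_commute algebra_simps)
    moreover have "(- v) \<bullet> (y t - x t) \<le> 0" "(- v') \<bullet> (x t - y t) \<le> 0"
      using cone mem[of t] mem'[of t] \<open>0 < t\<close> by auto
    ultimately have orth: "(- v) \<bullet> (y t - x t) = 0" "(- v') \<bullet> (x t - y t) = 0"
      by linarith+
    obtain z where z: "\<And>i. i \<in> I \<Longrightarrow> polyhedron (C i) \<and> z - c i t \<in> C i \<or> z - c i t \<in> rel_interior (C i)"
      using slater[of t] \<open>0 < t\<close> by auto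
    obtain \<delta> \<kappa> where "\<delta> > 0" "\<kappa> \<ge> 0" and reg:
      "\<And>a b x' \<epsilon>. \<forall>i\<in>I. norm (b i - c i t) \<le> \<delta> \<Longrightarrow> \<exists>w. \<forall>i\<in>I. w - b i \<in> C i \<Longrightarrow> \<epsilon> \<ge> 0 \<Longrightarrow>
      \<forall>i\<in>I. x' - a i \<in> C i \<Longrightarrow> \<forall>i\<in>I. norm (a i - b i) \<le> \<epsilon> \<Longrightarrow> norm x' \<le> norm ((1/2) *\<^sub>R (x t + y t)) + 1 \<Longrightarrow>
      \<exists>y. (\<forall>i\<in>I. y - b i \<in> C i) \<and> norm (x' - y) \<le> \<kappa> * \<epsilon>"
      by (rule intersection_translates_lipschitz[where C = C and z = z and a\<^sub>0 = "\<lambda>i. c i t"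
            and R = "norm ((1/2) *\<^sub>R (x t + y t)) + 1", OF \<open>finite I\<close> convex z]) blast+
    have ne: "\<exists>w. \<forall>i\<in>I. w - c i t \<in> C i"
      using mem[of t] \<open>0 < t\<close> by (auto simp: D)
    have in_C: "x s - c i s \<in> C i" "y s - c i s \<in> C i" if "0 \<le> s" "i \<in> I" for s i
      using mem[OF that(1)] mem'[OF that(1)] that(2) by (auto simp: D)
    have "(- v) \<bullet> (v' - v) \<le> 0"
    proof (rule midpoint_velocity_le[OF \<open>finite I\<close> convex \<open>\<kappa> \<ge> 0\<close> _ \<open>0 < t\<close> in_C v(1) v'(1) vc _ orth(1)])
      show "\<exists>q. (\<forall>i\<in>I. q - c i t \<in> C i) \<and> norm (z - q) \<le> \<kappa> * \<epsilon>"
        if "0 \<le> \<epsilon>" "\<forall>i\<in>I. z - a i \<in> C i" "\<forall>i\<in>I. norm (a i - c i t) \<le> \<epsilon>"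
          "norm z \<le> norm ((1/2) *\<^sub>R (x t + y t)) + 1" for a z \<epsilon>
        using reg[OF _ ne that] \<open>\<delta> > 0\<close> by simp
    qed (use cone(1) in \<open>auto simp: D\<close>)
    moreover have "(- v') \<bullet> (v - v') \<le> 0"
    proof (rule midpoint_velocity_le[OF \<open>finite I\<close> convex \<open>\<kappa> \<ge> 0\<close> _ \<open>0 < t\<close> in_C(2,1) v'(1) v(1) vc _ orth(2)])
      show "\<exists>q. (\<forall>i\<in>I. q - c i t \<in> C i) \<and> norm (z - q) \<le> \<kappa> * \<epsilon>"
        if "0 \<le> \<epsilon>" "\<forall>i\<in>I. z - a i \<in> C i" "\<forall>i\<in>I. norm (a i - c i t) \<le> \<epsilon>"
          "norm z \<le> norm ((1/2) *\<^sub>R (y t + x t)) + 1" for a z \<epsilon>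
        using reg[OF _ ne that(1-3)] that(4) \<open>\<delta> > 0\<close> by (simp add: add.commute)
    qed (use cone(2) in \<open>auto simp: D\<close>)
    ultimately have "(v - v') \<bullet> (v - v') \<le> 0"
      by (simp add: inner_commute algebra_simps)
    then have "v - v' = 0"
      using inner_ge_zero[of "v - v'"] inner_eq_zero_iff[of "v - v'"] by linarith
    then show ?thesis
      using \<open>((\<lambda>t. x t - y t) has_vector_derivative (v - v')) (at t)\<close> by simp
  qed
  show ?thesis
    by (rule lipschitz_zero_derivative_constant[OF lipschitz_on_diff[OF L L'] \<open>negligible K\<close> deriv0 \<open>0 \<le> t\<close>])
qed

section \<open>Convergence to a periodic solution\<close>

lemma sweeping_solution_asymptotically_periodic:
  fixes D :: "real \<Rightarrow> 'a::euclidean_space set"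
  assumes "T > 0" and per: "\<And>t (n::int). D (t + of_int n * T) = D t"
    and "closed (D 0)" and bdd: "\<And>t. D t \<subseteq> cball 0 R"
    and exists: "\<And>w. w \<in> D 0 \<Longrightarrow> \<exists>y. sweeping_solution D y \<and> y 0 = w"
    and rigid: "\<And>y z l t. sweeping_solution D y \<Longrightarrow> sweeping_solution D z \<Longrightarrow>
      (\<And>s. 0 \<le> s \<Longrightarrow> norm (y s - z s) = l) \<Longrightarrow> 0 \<le> t \<Longrightarrow> y t - z t = y 0 - z 0"
    and x: "sweeping_solution D x"
  obtains y where "sweeping_solution D y" "y T = y 0" "((\<lambda>t. norm (x t - y t)) \<longlongrightarrow> 0) at_top"
proof -
  have shift: "sweeping_solution D (\<lambda>t. u (t + real n * T))" if "sweeping_solution D u" for u n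
    using per[of _ "int n"] \<open>T > 0\<close> by (intro sweeping_solution_shift[OF that]) auto
  have mem: "u t \<in> D t" if "sweeping_solution D u" "0 \<le> t" for u t
    using that by (simp add: sweeping_solution_def)
  have "compact (D 0)"
    using \<open>closed (D 0)\<close> bounded_subset[OF bounded_cball bdd] by (simp add: compact_eq_bounded_closed)
  moreover have "x (real n * T) \<in> D 0" for n
    using mem[OF shift[OF x], of 0 n] by simp
  ultimately obtain w r where w: "w \<in> D 0" and "strict_mono (r :: nat \<Rightarrow> nat)"
    and lim: "((\<lambda>n. x (real n * T)) \<circ> r) \<longlonglongrightarrow> w"
    unfolding compact_def by metis
  obtain y where y: "sweeping_solution D y" "y 0 = w"
    using exists[OF w] by blast
  have close: "norm (x (t + real n * T) - y t) \<le> norm (x (real n * T) - w)" if "0 \<le> t" for t n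
    using sweeping_solutions_norm_nonincreasing[OF shift[OF x] y(1) order_refl that] y(2) by simp
  have lim0: "(\<lambda>k. norm (x (real (r k) * T) - w)) \<longlonglongrightarrow> 0"
    using tendsto_norm_zero[OF LIM_zero[OF lim]] by (simp add: o_def)
  \<comment> \<open>Convergence at the single time \<open>0\<close> spreads to all later times
    because the shifted solutions do not move away from \<open>y\<close>.\<close>
  have conv: "(\<lambda>k. x (t + real (r k) * T)) \<longlonglongrightarrow> y t" if "0 \<le> t" for t
    by (rule LIM_zero_cancel, rule Lim_null_comparison[OF _ lim0]) (use close[OF that] in auto)
  define d where "d s = norm (x (s + T) - x s)" for s
  have d_mono: "d t \<le> d s" if "0 \<le> s" "s \<le> t" for s t
    using sweeping_solutions_norm_nonincreasing[OF shift[OF x, of 1] x that] by (simp add: d_def)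
  define l where "l = Inf (d ` {0..})"
  have bdd_d: "bdd_below (d ` {0..})"
    by (rule bdd_belowI[of _ 0]) (auto simp: d_def)
  have d_lim: "(d \<longlongrightarrow> l) at_top"
  proof (rule order_tendstoI)
    fix a assume "a < l"
    moreover have "l \<le> d s" if "0 \<le> s" for s
      unfolding l_def using that bdd_d by (intro cInf_lower) auto
    ultimately show "\<forall>\<^sub>F s in at_top. a < d s"
      unfolding eventually_at_top_linorder by (intro exI[of _ 0]) force
  next
    fix a assume "l < a"
    then obtain s where "0 \<le> s" "d s < a"
      unfolding l_def using cInf_lessD[of "d ` {0..}" a] by auto
    then show "\<forall>\<^sub>F s in at_top. d s < a"
      unfolding eventually_at_top_linorder using d_mono[of s] by (intro exI[of _ s]) (meson le_less_trans)
  qed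
  have r_top: "filterlim (\<lambda>k. t + real (r k) * T) at_top sequentially" for t
    using \<open>T > 0\<close> filterlim_subseq[OF \<open>strict_mono r\<close>]
    by (intro filterlim_tendsto_add_at_top[OF tendsto_const] filterlim_at_top_mult_tendsto_pos[OF tendsto_const]
        filterlim_compose[OF filterlim_real_sequentially]) auto
  have iso: "norm (y (t + real 1 * T) - y t) = l" if "0 \<le> t" for t
  proof (rule LIMSEQ_unique)
    show "(\<lambda>k. d (t + real (r k) * T)) \<longlonglongrightarrow> l"
      by (rule filterlim_compose[OF d_lim r_top])
    have "(\<lambda>k. norm (x ((t + T) + real (r k) * T) - x (t + real (r k) * T))) \<longlonglongrightarrow> norm (y (t + T) - y t)"
      using that \<open>T > 0\<close> by (intro tendsto_intros conv) auto
    then show "(\<lambda>k. d (t + real (r k) * T)) \<longlonglongrightarrow> norm (y (t + real 1 * T) - y t)"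
      by (simp add: d_def algebra_simps)
  qed
  define e where "e = y T - y 0"
  have e: "y (t + T) = y t + e" if "0 \<le> t" for t
    using rigid[OF shift[OF y(1), of 1] y(1) iso that] by (simp add: e_def algebra_simps)
  have y_n: "y (t + real n * T) = y t + real n *\<^sub>R e" if "0 \<le> t" for t n
  proof (induction n)
    case (Suc n)
    have "y (t + real (Suc n) * T) = y ((t + real n * T) + T)"
      by (simp add: algebra_simps)
    also have "\<dots> = y (t + real n * T) + e"
      using that \<open>T > 0\<close> by (intro e) simp
    finally show ?case
      using Suc by (simp add: algebra_simps)
  qed simp
  have "e = 0"
  proof (rule ccontr)
    assume "e \<noteq> 0"
    then obtain n where n: "2 * R < real n * norm e"
      using reals_Archimedean3[of "norm e"] by auto
    have "norm (y (real n * T)) \<le> R" "norm (y 0) \<le> R"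
      using mem[OF y(1), of "real n * T"] mem[OF y(1), of 0] bdd[of 0] bdd[of "real n * T"] \<open>T > 0\<close> by auto
    moreover have "real n *\<^sub>R e = y (real n * T) - y 0"
      using y_n[of 0 n] by simp
    then have "real n * norm e \<le> norm (y (real n * T)) + norm (y 0)"
      by (metis norm_scaleR norm_triangle_ineq4 abs_of_nat)
    ultimately show False
      using n by linarith
  qed
  have "((\<lambda>t. norm (x t - y t)) \<longlongrightarrow> 0) at_top"
  proof (rule order_tendstoI)
    fix a :: real assume "a < 0"
    then show "\<forall>\<^sub>F t in at_top. a < norm (x t - y t)"
      by (intro always_eventually allI) (rule less_le_trans[OF _ norm_ge_zero])
  next
    fix a :: real assume "0 < a"
    then obtain k where k: "norm (x (real (r k) * T) - w) < a"
      using order_tendstoD(2)[OF lim0] by (auto simp: eventually_sequentially)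
    \<comment> \<open>Periodicity of \<open>y\<close> identifies \<open>y t\<close> with its value
      \<open>r k\<close> periods earlier, where \<open>close\<close> applies. One good index
      \<open>k\<close> therefore controls all later times, not only those of a subsequence.\<close>
    have "norm (x t - y t) < a" if "t \<ge> real (r k) * T" for t
    proof -
      have "y t = y (t - real (r k) * T)"
        using y_n[of "t - real (r k) * T" "r k"] that \<open>e = 0\<close> by simp
      then show ?thesis
        using close[of "t - real (r k) * T" "r k"] that k by simp
    qed
    then show "\<forall>\<^sub>F t in at_top. norm (x t - y t) < a"
      unfolding eventually_at_top_linorder by blast
  qed
  moreover have "y T = y 0"
    using \<open>e = 0\<close> by (simp add: e_def)
  ultimately show thesis
    using y(1) that by blast
qed

lemma mem_translate_iff: "x \<in> translate A v \<longleftrightarrow> x - v \<in> A"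
  by (force simp: translate_def image_iff)

lemma translate_eq_plus_image: "translate A v = (+) v ` A"
  by (auto simp: translate_def add.commute)

theorem theorem3:
  fixes C :: "nat \<Rightarrow> 'a::euclidean_space set"
    and c :: "nat \<Rightarrow> real \<Rightarrow> 'a"
    and k p :: nat and T :: real
  assumes T_pos: "T > 0"
    and p_le: "p \<le> k"
    and closed: "\<And>i. i \<in> {1..k} \<Longrightarrow> closed (C i)"
    and convex: "\<And>i. i \<in> {1..k} \<Longrightarrow> convex (C i)"
    and poly: "\<And>i. i \<in> {1..p} \<Longrightarrow> polyhedron (C i)"
    and lip: "\<And>i. i \<in> {1..k} \<Longrightarrow> \<exists>L. L-lipschitz_on UNIV (c i)"
    and per: "\<And>i t. i \<in> {1..k} \<Longrightarrow> c i (t + T) = c i t"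
    and bdd: "\<exists>R. \<forall>t. (\<Inter>i\<in>{1..k}. translate (C i) (c i t)) \<subseteq> cball 0 R"
    and slater: "\<And>t. t \<in> {0..T} \<Longrightarrow>
        (\<Inter>i\<in>{1..p}. translate (C i) (c i t)) \<inter>
        (\<Inter>i\<in>{p+1..k}. translate (rel_interior (C i)) (c i t)) \<noteq> {}"
  shows "(\<forall>t\<ge>0. periodic_set (\<lambda>t. \<Inter>i\<in>{1..k}. translate (C i) (c i t)) T t \<noteq> {}) \<and>
    (\<forall>x. sweeping_solution (\<lambda>t. \<Inter>i\<in>{1..k}. translate (C i) (c i t)) x \<longrightarrow>
      ((\<lambda>t. infdist (x t) (periodic_set (\<lambda>t. \<Inter>i\<in>{1..k}. translate (C i) (c i t)) T t))
        \<longlongrightarrow> 0) at_top)"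
proof -
  define D where "D t = (\<Inter>i\<in>{1..k}. translate (C i) (c i t))" for t
  have D: "z \<in> D t \<longleftrightarrow> (\<forall>i\<in>{1..k}. z - c i t \<in> C i)" for z t
    by (simp add: D_def mem_translate_iff)
  obtain R where R: "\<And>t. D t \<subseteq> cball 0 R"
    using bdd by (auto simp: D_def)
  have per_c: "c i (t + of_int n * T) = c i t" if "i \<in> {1..k}" for i t n
    using per[OF that] by (rule periodic_add_of_int_mult)
  then have per_D: "D (t + of_int n * T) = D t" for t n
    by (simp add: D_def)
  have slater': "\<exists>z. \<forall>i\<in>{1..k}. polyhedron (C i) \<and> z - c i t \<in> C i \<or> z - c i t \<in> rel_interior (C i)" for t
  proof -
    obtain n where n: "t + of_int n * T \<in> {0..T}"
      using exists_int_shift_into_period[OF T_pos] .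
    define t' where "t' = t + of_int n * T"
    obtain z where "z \<in> (\<Inter>i\<in>{1..p}. translate (C i) (c i t')) \<inter>
        (\<Inter>i\<in>{p+1..k}. translate (rel_interior (C i)) (c i t'))"
      using slater n unfolding t'_def by blast
    then have z: "\<And>i. i \<in> {1..p} \<Longrightarrow> z - c i t' \<in> C i"
      "\<And>i. i \<in> {p+1..k} \<Longrightarrow> z - c i t' \<in> rel_interior (C i)"
      by (simp_all add: mem_translate_iff)
    have "polyhedron (C i) \<and> z - c i t \<in> C i \<or> z - c i t \<in> rel_interior (C i)" if "i \<in> {1..k}" for i
    proof -
      have "c i t' = c i t"
        unfolding t'_def using that by (rule per_c)
      then show ?thesis
        using z[of i] poly[of i] that by (cases "i \<le> p") auto
    qed
    then show ?thesis
      by blast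
  qed
  have ne: "D t \<noteq> {}" for t
    using slater'[of t] rel_interior_subset by (fastforce simp: D)
  have closed_D: "closed (D t)" and convex_D: "convex (D t)" for t
    unfolding D_def translate_eq_plus_image using closed convex
    by (auto intro!: closed_INT convex_INT closed_translation convex_translation)
  obtain \<kappa> where \<kappa>: "\<kappa> \<ge> 0" "\<And>s t z. z \<in> D s \<Longrightarrow> \<exists>y\<in>D t. norm (z - y) \<le> \<kappa> * \<bar>s - t\<bar>"
    by (rule intersection_translates_hausdorff_lipschitz[where I = "{1..k}" and C = C and c = c and D = D and T = T and R = R,
          OF finite_atLeastAtMost convex T_pos slater' lip D R per_D]) blast+
  \<comment> \<open>The estimate for \<open>\<kappa>\<close> is global in time, so any positive
    bound on the mesh size will do; \<open>1\<close> is chosen.\<close>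
  have exists: "\<exists>y. sweeping_solution D y \<and> y 0 = w" if "w \<in> D 0" for w
    by (rule sweeping_solution_exists[where R = R and \<kappa> = \<kappa> and \<eta> = 1, OF closed_D convex_D ne R _ \<kappa>(1) \<kappa>(2) that]) auto
  have rigid: "y t - z t = y 0 - z 0"
    if "sweeping_solution D y" "sweeping_solution D z" "\<And>s. 0 \<le> s \<Longrightarrow> norm (y s - z s) = l" "0 \<le> t" for y z l t
    by (rule sweeping_solutions_isometric_imp_translate[where I = "{1..k}" and C = C and c = c and D = D,
          OF finite_atLeastAtMost convex slater' lip D that])
  have main: "\<exists>y. sweeping_solution D y \<and> y T = y 0 \<and> ((\<lambda>t. norm (x t - y t)) \<longlongrightarrow> 0) at_top"
    if x: "sweeping_solution D x" for x
    by (rule sweeping_solution_asymptotically_periodic[where D = D and T = T and R = R,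
          OF T_pos per_D closed_D R exists rigid x]) blast+
  \<comment> \<open>Nonemptiness gives the attraction statement its content: \<open>infdist\<close>
    to the empty set is \<open>0\<close> by convention.\<close>
  have "periodic_set D T t \<noteq> {}" for t
  proof -
    obtain w where "w \<in> D 0"
      using ne by blast
    then obtain x where "sweeping_solution D x"
      using exists by blast
    then obtain y where "sweeping_solution D y" "y T = y 0"
      using main by blast
    then show ?thesis
      by (auto simp: periodic_set_def)
  qed
  moreover have "((\<lambda>t. infdist (x t) (periodic_set D T t)) \<longlongrightarrow> 0) at_top" if x: "sweeping_solution D x" for x
  proof -
    obtain y where y: "sweeping_solution D y" "y T = y 0" "((\<lambda>t. norm (x t - y t)) \<longlongrightarrow> 0) at_top"
      using main[OF x] by blast
    have "infdist (x t) (periodic_set D T t) \<le> norm (x t - y t)" for t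
      using y(1,2) infdist_le[of "y t" "periodic_set D T t" "x t"] by (auto simp: periodic_set_def dist_norm)
    then show ?thesis
      by (intro Lim_null_comparison[OF _ y(3)] always_eventually allI) (simp add: infdist_nonneg)
  qed
  ultimately show ?thesis
    unfolding D_def by blast
qed

end
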